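(* Let $\mathbf{T}=(T,m,e)$ be an opmonoidal monad on a monoidal category $(\mathbb{V},\otimes,\mathbb{I})$ and let $\mathbf{C}=(C,\delta,\varepsilon)$ be a comonoid in $\mathbb{V}$ with a grouplike element $g:\mathbb{I}\to C$. The following are equivalent: (a) the functor $K_{g,\mathbf{C}}:\mathbb{V}\to(\mathbb{V}_T)^{\phi_T(\mathbf{C})}$, $V\mapsto((T(V),m_V),(T(V)\otimes T(g))\cdot\chi_{V,\mathbb{I}})$, is an equivalence of categories; (b) the functor $K_{1_{\mathbb{I}},\mathbf{I}}:\mathbb{V}\to(\mathbb{V}_T)^{\phi_T(\mathbf{I})}$, $V\mapsto((T(V),m_V),\chi_{V,\mathbb{I}})$, is an equivalence of categories and $g$ is an isomorphism; (c) (i) $\mathbf{T}$ (with the comodule structure $\chi_{-,\mathbb{I}}:T(-)\to T(-)\otimes T(\mathbb{I})$) is $\mathbf{G}_{T(\mathbf{I})}$-Galois, (ii) $\mathbf{T}$ is of effective descent type, and (iii) $g$ is an isomorphism.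
   Context: Monoidal categories are taken to be strict. An opmonoidal monad on $\mathbb{V}$ is a monad $(T,m,e)$ together with a natural transformation $\chi_{V,W}:T(V\otimes W)\to T(V)\otimes T(W)$ and a morphism $\theta:T(\mathbb{I})\to\mathbb{I}$ such that $(\chi_{U,V}\otimes T(W))\chi_{U\otimes V,W}=(T(U)\otimes\chi_{V,W})\chi_{U,V\otimes W}$, $(\theta\otimes T(V))\chi_{\mathbb{I},V}=1=(T(V)\otimes\theta)\chi_{V,\mathbb{I}}$, $\chi_{V,W}m_{V\otimes W}=(m_V\otimes m_W)\chi_{T(V),T(W)}T(\chi_{V,W})$, $\theta m_{\mathbb{I}}=\theta T(\theta)$, $\chi_{V,W}e_{V\otimes W}=e_V\otimes e_W$, $\theta e_{\mathbb{I}}=1$. The Eilenberg–Moore category $\mathbb{V}_T$ is monoidal with $(V,h)\otimes(W,k)=(V\otimes W,(h\otimes k)\chi_{V,W})$ and unit $(\mathbb{I},\theta)$. For a comonoid $\mathbf{C}=(C,\delta,\varepsilon)$ in $\mathbb{V}$, $\phi_T(\mathbf{C})=((T(C),m_C),\chi_{C,C}\cdot T(\delta),\theta\cdot T(\varepsilon))$ is a comonoid in $\mathbb{V}_T$, and $(\mathbb{V}_T)^{\phi_T(\mathbf{C})}$ is the category of right $\phi_T(\mathbf{C})$-comodules in $\mathbb{V}_T$. $\mathbf{I}=(\mathbb{I},1,1)$ is the trivial comonoid. A grouplike element $g:\mathbb{I}\to C$ is a comonoid morphism $\mathbf{I}\to\mathbf{C}$: $\varepsilon g=1$, $\delta g=g\otimes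 g$. $\mathbf{G}_{T(\mathbf{I})}$ is the comonad $-\otimes T(\mathbb{I})$ on $\mathbb{V}$ given by the comonoid $(T(\mathbb{I}),\chi_{\mathbb{I},\mathbb{I}},\theta)$; $\mathbf{T}$ is $\mathbf{G}_{T(\mathbf{I})}$-Galois if for every $V$ the composite $TT(V)\xrightarrow{\chi_{T(V),\mathbb{I}}}TT(V)\otimes T(\mathbb{I})\xrightarrow{m_V\otimes T(\mathbb{I})}T(V)\otimes T(\mathbb{I})$ is an isomorphism. $\mathbf{T}$ is of effective descent type if the free functor $\phi_T:\mathbb{V}\to\mathbb{V}_T$ is comonadic (the comparison functor to coalgebras over the comonad $\phi_TU_T$ is an equivalence). *)

theory Defs
  imports Main
begin

section \<open>Categories, functors, equivalences\<close>

record ('o, 'a) category =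
  Obj :: "'o set"
  Arr :: "'a set"
  Dom :: "'a \<Rightarrow> 'o"
  Cod :: "'a \<Rightarrow> 'o"
  ident :: "'o \<Rightarrow> 'a"
  compose :: "'a \<Rightarrow> 'a \<Rightarrow> 'a"  (infixl "\<cdot>\<index>" 65)

definition hom :: "('o, 'a, 'm) category_scheme \<Rightarrow> 'o \<Rightarrow> 'o \<Rightarrow> 'a set"
  where "hom C A B = {f \<in> Arr C. Dom C f = A \<and> Cod C f = B}"

locale category =
  fixes C (structure)
  assumes Dom_in: "f \<in> Arr C \<Longrightarrow> Dom C f \<in> Obj C"
    and Cod_in: "f \<in> Arr C \<Longrightarrow> Cod C f \<in> Obj C"
    and ident_in: "A \<in> Obj C \<Longrightarrow> ident C A \<in> hom C A A"
    and compose_in: "\<lbrakk>f \<in> hom C A B; g \<in> hom C B D\<rbrakk> \<Longrightarrow> g \<cdot> f \<in> hom C A D"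
    and ident_left: "f \<in> hom C A B \<Longrightarrow> ident C B \<cdot> f = f"
    and ident_right: "f \<in> hom C A B \<Longrightarrow> f \<cdot> ident C A = f"
    and compose_assoc:
      "\<lbrakk>f \<in> hom C A B; g \<in> hom C B D; h \<in> hom C D E\<rbrakk> \<Longrightarrow> (h \<cdot> g) \<cdot> f = h \<cdot> (g \<cdot> f)"

definition is_iso :: "('o, 'a, 'm) category_scheme \<Rightarrow> 'a \<Rightarrow> bool"
  where "is_iso C f \<longleftrightarrow> f \<in> Arr C \<and>
    (\<exists>g \<in> hom C (Cod C f) (Dom C f).
      g \<cdot>\<^bsub>C\<^esub> f = ident C (Dom C f) \<and> f \<cdot>\<^bsub>C\<^esub> g = ident C (Cod C f))"

record ('o, 'a, 'p, 'b) cfunctor =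
  fob :: "'o \<Rightarrow> 'p"
  farr :: "'a \<Rightarrow> 'b"

locale cfunctor =
  source: category C + target: category D for C and D +
  fixes F
  assumes fob_in: "A \<in> Obj C \<Longrightarrow> fob F A \<in> Obj D"
    and farr_in: "f \<in> hom C A B \<Longrightarrow> farr F f \<in> hom D (fob F A) (fob F B)"
    and farr_ident: "A \<in> Obj C \<Longrightarrow> farr F (ident C A) = ident D (fob F A)"
    and farr_compose: "\<lbrakk>f \<in> hom C A B; g \<in> hom C B E\<rbrakk> \<Longrightarrow>
      farr F (g \<cdot>\<^bsub>C\<^esub> f) = farr F g \<cdot>\<^bsub>D\<^esub> farr F f"

definition id_functor :: "('o, 'a, 'o, 'a) cfunctor"
  where "id_functor = \<lparr>fob = (\<lambda>A. A), farr = (\<lambda>f. f)\<rparr>"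

definition comp_functor ::
    "('p, 'b, 'q, 'c, 'm) cfunctor_scheme \<Rightarrow> ('o, 'a, 'p, 'b, 'n) cfunctor_scheme
      \<Rightarrow> ('o, 'a, 'q, 'c) cfunctor"
  where "comp_functor G F = \<lparr>fob = (\<lambda>A. fob G (fob F A)), farr = (\<lambda>f. farr G (farr F f))\<rparr>"

definition nat_trans ::
    "('o, 'a, 'm) category_scheme \<Rightarrow> ('p, 'b, 'n) category_scheme
      \<Rightarrow> ('o, 'a, 'p, 'b, 'k) cfunctor_scheme \<Rightarrow> ('o, 'a, 'p, 'b, 'l) cfunctor_scheme
      \<Rightarrow> ('o \<Rightarrow> 'b) \<Rightarrow> bool"
  where "nat_trans C D F G t \<longleftrightarrow>
    (\<forall>A \<in> Obj C. t A \<in> hom D (fob F A) (fob G A)) \<and>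
    (\<forall>A \<in> Obj C. \<forall>B \<in> Obj C. \<forall>f \<in> hom C A B.
      t B \<cdot>\<^bsub>D\<^esub> farr F f = farr G f \<cdot>\<^bsub>D\<^esub> t A)"

definition nat_iso ::
    "('o, 'a, 'm) category_scheme \<Rightarrow> ('p, 'b, 'n) category_scheme
      \<Rightarrow> ('o, 'a, 'p, 'b, 'k) cfunctor_scheme \<Rightarrow> ('o, 'a, 'p, 'b, 'l) cfunctor_scheme
      \<Rightarrow> ('o \<Rightarrow> 'b) \<Rightarrow> bool"
  where "nat_iso C D F G t \<longleftrightarrow> nat_trans C D F G t \<and> (\<forall>A \<in> Obj C. is_iso D (t A))"

definition equivalence_of_categories ::
    "('o, 'a, 'm) category_scheme \<Rightarrow> ('p, 'b, 'n) category_scheme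
      \<Rightarrow> ('o, 'a, 'p, 'b, 'k) cfunctor_scheme \<Rightarrow> bool"
  where "equivalence_of_categories C D F \<longleftrightarrow> cfunctor C D F \<and>
    (\<exists>(G :: ('p, 'b, 'o, 'a) cfunctor) \<eta> \<epsilon>. cfunctor D C G \<and>
      nat_iso C C id_functor (comp_functor G F) \<eta> \<and>
      nat_iso D D (comp_functor F G) id_functor \<epsilon>)"

text \<open>
  The category whose objects are the pairs \<open>(A, a)\<close> of an object \<open>A\<close> of \<open>C\<close> and an arrow \<open>a\<close>
  satisfying \<open>P\<close>, and whose arrows are the arrows \<open>f : A \<rightarrow> B\<close> of \<open>C\<close> with \<open>Q (A, a) f (B, b)\<close>.
  Since the same \<open>f\<close> may underlie several such arrows, an arrow records its domain and codomain.
\<close>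

definition structured_category ::
    "('o, 'a, 'm) category_scheme \<Rightarrow> ('o \<times> 'a \<Rightarrow> bool)
      \<Rightarrow> ('o \<times> 'a \<Rightarrow> 'a \<Rightarrow> 'o \<times> 'a \<Rightarrow> bool)
      \<Rightarrow> ('o \<times> 'a, ('o \<times> 'a) \<times> 'a \<times> ('o \<times> 'a)) category"
  where "structured_category C P Q =
    \<lparr>Obj = {X. P X},
     Arr = {(X, f, Y). P X \<and> P Y \<and> f \<in> hom C (fst X) (fst Y) \<and> Q X f Y},
     Dom = (\<lambda>(X, f, Y). X),
     Cod = (\<lambda>(X, f, Y). Y),
     ident = (\<lambda>X. (X, ident C (fst X), X)),
     compose = (\<lambda>(Y', g, Z) (X, f, Y). (X, g \<cdot>\<^bsub>C\<^esub> f, Z))\<rparr>"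


section \<open>Comonads and comonadic functors\<close>

record ('o, 'a) comonad = "('o, 'a, 'o, 'a) cfunctor" +
  comult :: "'o \<Rightarrow> 'a"
  counit :: "'o \<Rightarrow> 'a"

definition is_coalgebra ::
    "('o, 'a, 'm) category_scheme \<Rightarrow> ('o, 'a, 'n) comonad_scheme \<Rightarrow> 'o \<times> 'a \<Rightarrow> bool"
  where "is_coalgebra C G = (\<lambda>(A, a).
    A \<in> Obj C \<and> a \<in> hom C A (fob G A) \<and>
    comult G A \<cdot>\<^bsub>C\<^esub> a = farr G a \<cdot>\<^bsub>C\<^esub> a \<and>
    counit G A \<cdot>\<^bsub>C\<^esub> a = ident C A)"

definition coalgebra_category ::
    "('o, 'a, 'm) category_scheme \<Rightarrow> ('o, 'a, 'n) comonad_scheme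
      \<Rightarrow> ('o \<times> 'a, ('o \<times> 'a) \<times> 'a \<times> ('o \<times> 'a)) category"
  where "coalgebra_category C G =
    structured_category C (is_coalgebra C G)
      (\<lambda>(A, a) f (B, b). b \<cdot>\<^bsub>C\<^esub> f = farr G f \<cdot>\<^bsub>C\<^esub> a)"

text \<open>
  For an adjunction with left adjoint \<open>F : C \<rightarrow> D\<close>, right adjoint \<open>U : D \<rightarrow> C\<close>, unit \<open>\<eta>\<close> and
  counit \<open>\<epsilon>\<close>: the comonad \<open>F U\<close> on \<open>D\<close>, and the comparison functor from \<open>C\<close> to its coalgebras.
\<close>

definition adjunction_comonad ::
    "('o, 'a, 'p, 'b) cfunctor \<Rightarrow> ('p, 'b, 'o, 'a) cfunctor
      \<Rightarrow> ('o \<Rightarrow> 'a) \<Rightarrow> ('p \<Rightarrow> 'b) \<Rightarrow> ('p, 'b) comonad"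
  where "adjunction_comonad F U \<eta> \<epsilon> =
    \<lparr>fob = fob (comp_functor F U), farr = farr (comp_functor F U),
     comult = (\<lambda>B. farr F (\<eta> (fob U B))), counit = \<epsilon>\<rparr>"

definition comparison_functor ::
    "('o, 'a, 'm) category_scheme \<Rightarrow> ('o, 'a, 'p, 'b) cfunctor \<Rightarrow> ('o \<Rightarrow> 'a)
      \<Rightarrow> ('o, 'a, 'p \<times> 'b, ('p \<times> 'b) \<times> 'b \<times> ('p \<times> 'b)) cfunctor"
  where "comparison_functor C F \<eta> =
    (let K = (\<lambda>A. (fob F A, farr F (\<eta> A)))
     in \<lparr>fob = K, farr = (\<lambda>f. (K (Dom C f), farr F f, K (Cod C f)))\<rparr>)"

definition comonadic ::
    "('o, 'a, 'm) category_scheme \<Rightarrow> ('p, 'b, 'n) category_scheme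
      \<Rightarrow> ('o, 'a, 'p, 'b) cfunctor \<Rightarrow> ('p, 'b, 'o, 'a) cfunctor
      \<Rightarrow> ('o \<Rightarrow> 'a) \<Rightarrow> ('p \<Rightarrow> 'b) \<Rightarrow> bool"
  where "comonadic C D F U \<eta> \<epsilon> \<longleftrightarrow>
    equivalence_of_categories C (coalgebra_category D (adjunction_comonad F U \<eta> \<epsilon>))
      (comparison_functor C F \<eta>)"


section \<open>Strict monoidal categories, comonoids and comodules\<close>

record ('o, 'a) monoidal_category = "('o, 'a) category" +
  tensor :: "'o \<Rightarrow> 'o \<Rightarrow> 'o"  (infixr "\<otimes>\<index>" 70)
  tensor_arr :: "'a \<Rightarrow> 'a \<Rightarrow> 'a"  (infixr "\<boxtimes>\<index>" 70)
  unit_ob :: "'o"  ("\<I>\<index>")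

locale strict_monoidal_category = category V for V (structure) +
  assumes tensor_in: "\<lbrakk>A \<in> Obj V; B \<in> Obj V\<rbrakk> \<Longrightarrow> A \<otimes> B \<in> Obj V"
    and unit_in: "\<I> \<in> Obj V"
    and tensor_arr_in: "\<lbrakk>f \<in> hom V A A'; g \<in> hom V B B'\<rbrakk> \<Longrightarrow> f \<boxtimes> g \<in> hom V (A \<otimes> B) (A' \<otimes> B')"
    and tensor_ident: "\<lbrakk>A \<in> Obj V; B \<in> Obj V\<rbrakk> \<Longrightarrow> ident V A \<boxtimes> ident V B = ident V (A \<otimes> B)"
    and tensor_compose:
      "\<lbrakk>f \<in> hom V A A'; f' \<in> hom V A' A''; g \<in> hom V B B'; g' \<in> hom V B' B''\<rbrakk> \<Longrightarrow>
        (f' \<cdot> f) \<boxtimes> (g' \<cdot> g) = (f' \<boxtimes> g') \<cdot> (f \<boxtimes> g)"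
    and tensor_assoc:
      "\<lbrakk>A \<in> Obj V; B \<in> Obj V; D \<in> Obj V\<rbrakk> \<Longrightarrow> (A \<otimes> B) \<otimes> D = A \<otimes> (B \<otimes> D)"
    and tensor_arr_assoc:
      "\<lbrakk>f \<in> Arr V; g \<in> Arr V; h \<in> Arr V\<rbrakk> \<Longrightarrow> (f \<boxtimes> g) \<boxtimes> h = f \<boxtimes> (g \<boxtimes> h)"
    and tensor_unit_left: "A \<in> Obj V \<Longrightarrow> \<I> \<otimes> A = A"
    and tensor_unit_right: "A \<in> Obj V \<Longrightarrow> A \<otimes> \<I> = A"
    and tensor_arr_unit_left: "f \<in> Arr V \<Longrightarrow> ident V \<I> \<boxtimes> f = f"
    and tensor_arr_unit_right: "f \<in> Arr V \<Longrightarrow> f \<boxtimes> ident V \<I> = f"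

record ('o, 'a) comonoid =
  car :: "'o"
  delta :: "'a"
  eps :: "'a"

locale comonoid = strict_monoidal_category V for V (structure) +
  fixes C
  assumes car_in: "car C \<in> Obj V"
    and delta_in: "delta C \<in> hom V (car C) (car C \<otimes> car C)"
    and eps_in: "eps C \<in> hom V (car C) \<I>"
    and coassoc: "(delta C \<boxtimes> ident V (car C)) \<cdot> delta C = (ident V (car C) \<boxtimes> delta C) \<cdot> delta C"
    and counit_left: "(eps C \<boxtimes> ident V (car C)) \<cdot> delta C = ident V (car C)"
    and counit_right: "(ident V (car C) \<boxtimes> eps C) \<cdot> delta C = ident V (car C)"

definition comonoid_morphism ::
    "('o, 'a, 'm) monoidal_category_scheme \<Rightarrow> ('o, 'a) comonoid \<Rightarrow> ('o, 'a) comonoid \<Rightarrow> 'a \<Rightarrow> bool"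
  where "comonoid_morphism V C D f \<longleftrightarrow>
    f \<in> hom V (car C) (car D) \<and>
    eps D \<cdot>\<^bsub>V\<^esub> f = eps C \<and>
    delta D \<cdot>\<^bsub>V\<^esub> f = (f \<boxtimes>\<^bsub>V\<^esub> f) \<cdot>\<^bsub>V\<^esub> delta C"

definition trivial_comonoid :: "('o, 'a, 'm) monoidal_category_scheme \<Rightarrow> ('o, 'a) comonoid"
  where "trivial_comonoid V =
    \<lparr>car = \<I>\<^bsub>V\<^esub>, delta = ident V \<I>\<^bsub>V\<^esub>, eps = ident V \<I>\<^bsub>V\<^esub>\<rparr>"

definition grouplike ::
    "('o, 'a, 'm) monoidal_category_scheme \<Rightarrow> ('o, 'a) comonoid \<Rightarrow> 'a \<Rightarrow> bool"
  where "grouplike V C g \<longleftrightarrow> comonoid_morphism V (trivial_comonoid V) C g"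

definition comonoid_comonad ::
    "('o, 'a, 'm) monoidal_category_scheme \<Rightarrow> ('o, 'a) comonoid \<Rightarrow> ('o, 'a) comonad"
  where "comonoid_comonad V C =
    \<lparr>fob = (\<lambda>A. A \<otimes>\<^bsub>V\<^esub> car C), farr = (\<lambda>f. f \<boxtimes>\<^bsub>V\<^esub> ident V (car C)),
     comult = (\<lambda>A. ident V A \<boxtimes>\<^bsub>V\<^esub> delta C), counit = (\<lambda>A. ident V A \<boxtimes>\<^bsub>V\<^esub> eps C)\<rparr>"

definition is_right_comodule ::
    "('o, 'a, 'm) monoidal_category_scheme \<Rightarrow> ('o, 'a) comonoid \<Rightarrow> 'o \<times> 'a \<Rightarrow> bool"
  where "is_right_comodule V C = (\<lambda>(A, \<rho>).
    A \<in> Obj V \<and> \<rho> \<in> hom V A (A \<otimes>\<^bsub>V\<^esub> car C) \<and>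
    (\<rho> \<boxtimes>\<^bsub>V\<^esub> ident V (car C)) \<cdot>\<^bsub>V\<^esub> \<rho> = (ident V A \<boxtimes>\<^bsub>V\<^esub> delta C) \<cdot>\<^bsub>V\<^esub> \<rho> \<and>
    (ident V A \<boxtimes>\<^bsub>V\<^esub> eps C) \<cdot>\<^bsub>V\<^esub> \<rho> = ident V A)"

definition comodule_category ::
    "('o, 'a, 'm) monoidal_category_scheme \<Rightarrow> ('o, 'a) comonoid
      \<Rightarrow> ('o \<times> 'a, ('o \<times> 'a) \<times> 'a \<times> ('o \<times> 'a)) category"
  where "comodule_category V C =
    structured_category V (is_right_comodule V C)
      (\<lambda>(A, \<rho>) f (B, \<sigma>). \<sigma> \<cdot>\<^bsub>V\<^esub> f = (f \<boxtimes>\<^bsub>V\<^esub> ident V (car C)) \<cdot>\<^bsub>V\<^esub> \<rho>)"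


section \<open>Monads and opmonoidal monads\<close>

record ('o, 'a) monad = "('o, 'a, 'o, 'a) cfunctor" +
  mult :: "'o \<Rightarrow> 'a"
  munit :: "'o \<Rightarrow> 'a"

locale monad = cfunctor C C T for C (structure) and T +
  assumes mult_nat: "nat_trans C C (comp_functor T T) T (mult T)"
    and munit_nat: "nat_trans C C id_functor T (munit T)"
    and mult_assoc: "A \<in> Obj C \<Longrightarrow> mult T A \<cdot> mult T (fob T A) = mult T A \<cdot> farr T (mult T A)"
    and munit_left: "A \<in> Obj C \<Longrightarrow> mult T A \<cdot> munit T (fob T A) = ident C (fob T A)"
    and munit_right: "A \<in> Obj C \<Longrightarrow> mult T A \<cdot> farr T (munit T A) = ident C (fob T A)"

record ('o, 'a) opmonoidal_monad = "('o, 'a) monad" +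
  chi :: "'o \<Rightarrow> 'o \<Rightarrow> 'a"
  theta :: "'a"

locale opmonoidal_monad = strict_monoidal_category V + monad V T for V (structure) and T +
  assumes chi_in:
      "\<lbrakk>A \<in> Obj V; B \<in> Obj V\<rbrakk> \<Longrightarrow> chi T A B \<in> hom V (fob T (A \<otimes> B)) (fob T A \<otimes> fob T B)"
    and chi_nat:
      "\<lbrakk>f \<in> hom V A A'; g \<in> hom V B B'\<rbrakk> \<Longrightarrow>
        chi T A' B' \<cdot> farr T (f \<boxtimes> g) = (farr T f \<boxtimes> farr T g) \<cdot> chi T A B"
    and theta_in: "theta T \<in> hom V (fob T \<I>) \<I>"
    and chi_coassoc:
      "\<lbrakk>A \<in> Obj V; B \<in> Obj V; D \<in> Obj V\<rbrakk> \<Longrightarrow>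
        (chi T A B \<boxtimes> ident V (fob T D)) \<cdot> chi T (A \<otimes> B) D =
        (ident V (fob T A) \<boxtimes> chi T B D) \<cdot> chi T A (B \<otimes> D)"
    and chi_counit_left:
      "A \<in> Obj V \<Longrightarrow> (theta T \<boxtimes> ident V (fob T A)) \<cdot> chi T \<I> A = ident V (fob T A)"
    and chi_counit_right:
      "A \<in> Obj V \<Longrightarrow> (ident V (fob T A) \<boxtimes> theta T) \<cdot> chi T A \<I> = ident V (fob T A)"
    and chi_mult:
      "\<lbrakk>A \<in> Obj V; B \<in> Obj V\<rbrakk> \<Longrightarrow>
        chi T A B \<cdot> mult T (A \<otimes> B) =
        (mult T A \<boxtimes> mult T B) \<cdot> chi T (fob T A) (fob T B) \<cdot> farr T (chi T A B)"
    and theta_mult: "theta T \<cdot> mult T \<I> = theta T \<cdot> farr T (theta T)"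
    and chi_munit:
      "\<lbrakk>A \<in> Obj V; B \<in> Obj V\<rbrakk> \<Longrightarrow> chi T A B \<cdot> munit T (A \<otimes> B) = munit T A \<boxtimes> munit T B"
    and theta_munit: "theta T \<cdot> munit T \<I> = ident V \<I>"


section \<open>The Eilenberg--Moore category\<close>

definition is_algebra ::
    "('o, 'a, 'm) category_scheme \<Rightarrow> ('o, 'a, 'n) monad_scheme \<Rightarrow> 'o \<times> 'a \<Rightarrow> bool"
  where "is_algebra C T = (\<lambda>(A, h).
    A \<in> Obj C \<and> h \<in> hom C (fob T A) A \<and>
    h \<cdot>\<^bsub>C\<^esub> mult T A = h \<cdot>\<^bsub>C\<^esub> farr T h \<and>
    h \<cdot>\<^bsub>C\<^esub> munit T A = ident C A)"

definition EM_category ::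
    "('o, 'a, 'm) category_scheme \<Rightarrow> ('o, 'a, 'n) monad_scheme
      \<Rightarrow> ('o \<times> 'a, ('o \<times> 'a) \<times> 'a \<times> ('o \<times> 'a)) category"
  where "EM_category C T =
    structured_category C (is_algebra C T)
      (\<lambda>(A, h) f (B, k). f \<cdot>\<^bsub>C\<^esub> h = k \<cdot>\<^bsub>C\<^esub> farr T f)"

definition EM_tensor ::
    "('o, 'a, 'm) monoidal_category_scheme \<Rightarrow> ('o, 'a, 'n) opmonoidal_monad_scheme
      \<Rightarrow> 'o \<times> 'a \<Rightarrow> 'o \<times> 'a \<Rightarrow> 'o \<times> 'a"
  where "EM_tensor V T = (\<lambda>(A, h) (B, k). (A \<otimes>\<^bsub>V\<^esub> B, (h \<boxtimes>\<^bsub>V\<^esub> k) \<cdot>\<^bsub>V\<^esub> chi T A B))"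

definition EM_monoidal ::
    "('o, 'a, 'm) monoidal_category_scheme \<Rightarrow> ('o, 'a, 'n) opmonoidal_monad_scheme
      \<Rightarrow> ('o \<times> 'a, ('o \<times> 'a) \<times> 'a \<times> ('o \<times> 'a)) monoidal_category"
  where "EM_monoidal V T =
    category.extend (EM_category V T)
      (monoidal_category.fields
        (EM_tensor V T)
        (\<lambda>(X, f, X') (Y, g, Y'). (EM_tensor V T X Y, f \<boxtimes>\<^bsub>V\<^esub> g, EM_tensor V T X' Y'))
        (\<I>\<^bsub>V\<^esub>, theta T))"

definition free_functor ::
    "('o, 'a, 'm) category_scheme \<Rightarrow> ('o, 'a, 'n) monad_scheme
      \<Rightarrow> ('o, 'a, 'o \<times> 'a, ('o \<times> 'a) \<times> 'a \<times> ('o \<times> 'a)) cfunctor"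
  where "free_functor C T =
    (let \<phi> = (\<lambda>A. (fob T A, mult T A))
     in \<lparr>fob = \<phi>, farr = (\<lambda>f. (\<phi> (Dom C f), farr T f, \<phi> (Cod C f)))\<rparr>)"

definition forgetful_functor ::
    "('o \<times> 'a, ('o \<times> 'a) \<times> 'a \<times> ('o \<times> 'a), 'o, 'a) cfunctor"
  where "forgetful_functor = \<lparr>fob = (\<lambda>(A, h). A), farr = (\<lambda>(X, f, Y). f)\<rparr>"

definition EM_counit ::
    "('o, 'a, 'm) category_scheme \<Rightarrow> ('o, 'a, 'n) monad_scheme
      \<Rightarrow> 'o \<times> 'a \<Rightarrow> ('o \<times> 'a) \<times> 'a \<times> ('o \<times> 'a)"
  where "EM_counit C T = (\<lambda>(A, h). (fob (free_functor C T) A, h, (A, h)))"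

definition effective_descent_type ::
    "('o, 'a, 'm) category_scheme \<Rightarrow> ('o, 'a, 'n) monad_scheme \<Rightarrow> bool"
  where "effective_descent_type C T \<longleftrightarrow>
    comonadic C (EM_category C T) (free_functor C T) forgetful_functor (munit T) (EM_counit C T)"

definition free_comonoid ::
    "('o, 'a, 'm) monoidal_category_scheme \<Rightarrow> ('o, 'a, 'n) opmonoidal_monad_scheme
      \<Rightarrow> ('o, 'a) comonoid \<Rightarrow> ('o \<times> 'a, ('o \<times> 'a) \<times> 'a \<times> ('o \<times> 'a)) comonoid"
  where "free_comonoid V T C =
    (let X = fob (free_functor V T) (car C)
     in \<lparr>car = X,
         delta = (X, chi T (car C) (car C) \<cdot>\<^bsub>V\<^esub> farr T (delta C), X \<otimes>\<^bsub>EM_monoidal V T\<^esub> X),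
         eps = (X, theta T \<cdot>\<^bsub>V\<^esub> farr T (eps C), \<I>\<^bsub>EM_monoidal V T\<^esub>)\<rparr>)"

definition EM_comodule_category ::
    "('o, 'a, 'm) monoidal_category_scheme \<Rightarrow> ('o, 'a, 'n) opmonoidal_monad_scheme
      \<Rightarrow> ('o, 'a) comonoid
      \<Rightarrow> (('o \<times> 'a) \<times> (('o \<times> 'a) \<times> 'a \<times> ('o \<times> 'a)),
           (('o \<times> 'a) \<times> (('o \<times> 'a) \<times> 'a \<times> ('o \<times> 'a))) \<times> (('o \<times> 'a) \<times> 'a \<times> ('o \<times> 'a)) \<times>
           (('o \<times> 'a) \<times> (('o \<times> 'a) \<times> 'a \<times> ('o \<times> 'a)))) category"
  where "EM_comodule_category V T C =
    comodule_category (EM_monoidal V T) (free_comonoid V T C)"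

text \<open>
  The target of the coaction below is the underlying object of
  \<open>\<phi>\<^sub>T(A) \<otimes> \<phi>\<^sub>T(C)\<close>; its source is \<open>T(A) = T(A \<otimes> \<I>)\<close> by strictness.
\<close>

definition K_functor ::
    "('o, 'a, 'm) monoidal_category_scheme \<Rightarrow> ('o, 'a, 'n) opmonoidal_monad_scheme
      \<Rightarrow> 'a \<Rightarrow> ('o, 'a) comonoid
      \<Rightarrow> ('o, 'a, ('o \<times> 'a) \<times> (('o \<times> 'a) \<times> 'a \<times> ('o \<times> 'a)),
           (('o \<times> 'a) \<times> (('o \<times> 'a) \<times> 'a \<times> ('o \<times> 'a))) \<times> (('o \<times> 'a) \<times> 'a \<times> ('o \<times> 'a)) \<times>
           (('o \<times> 'a) \<times> (('o \<times> 'a) \<times> 'a \<times> ('o \<times> 'a)))) cfunctor"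
  where "K_functor V T g C =
    (let \<phi> = free_functor V T;
         coact = (\<lambda>A. (fob \<phi> A,
           (ident V (fob T A) \<boxtimes>\<^bsub>V\<^esub> farr T g) \<cdot>\<^bsub>V\<^esub> chi T A \<I>\<^bsub>V\<^esub>,
           fob \<phi> A \<otimes>\<^bsub>EM_monoidal V T\<^esub> fob \<phi> (car C)));
         K = (\<lambda>A. (fob \<phi> A, coact A))
     in \<lparr>fob = K, farr = (\<lambda>f. (K (Dom V f), farr \<phi> f, K (Cod V f)))\<rparr>)"


section \<open>Galois monads\<close>

text \<open>
  \<open>\<alpha> : T \<rightarrow> G T\<close> is meant to be a left comodule structure on the functor \<open>T\<close> over the comonad \<open>G\<close>;
  the composite below is then \<open>T T(A) \<rightarrow> G T T(A) \<rightarrow> G T(A)\<close>.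
\<close>

definition Galois ::
    "('o, 'a, 'm) category_scheme \<Rightarrow> ('o, 'a, 'k) comonad_scheme \<Rightarrow> ('o, 'a, 'n) monad_scheme
      \<Rightarrow> ('o \<Rightarrow> 'a) \<Rightarrow> bool"
  where "Galois C G T \<alpha> \<longleftrightarrow>
    (\<forall>A \<in> Obj C. is_iso C (farr G (mult T A) \<cdot>\<^bsub>C\<^esub> \<alpha> (fob T A)))"

definition T_unit_comonoid ::
    "('o, 'a, 'm) monoidal_category_scheme \<Rightarrow> ('o, 'a, 'n) opmonoidal_monad_scheme
      \<Rightarrow> ('o, 'a) comonoid"
  where "T_unit_comonoid V T =
    \<lparr>car = fob T \<I>\<^bsub>V\<^esub>, delta = chi T \<I>\<^bsub>V\<^esub> \<I>\<^bsub>V\<^esub>, eps = theta T\<rparr>"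

end

theory Submission
  imports Defs
begin

text \<open>
  Write \<open>U\<close> for the forgetful functor of the Eilenberg--Moore category \<open>V\<^sub>T\<close>, and \<open>G\<close> for the comonad
  \<open>- \<otimes> \<phi>(C)\<close> on \<open>V\<^sub>T\<close>.  Right comodules over \<open>\<phi>(C)\<close> are exactly the \<open>G\<close>-coalgebras, so the
  functor \<open>K\<close> of the theorem lifts the left adjoint \<open>\<phi>\<close> through the coalgebras of a comonad.  Any
  such lift amounts to a natural coaction \<open>\<kappa> : \<phi> \<rightarrow> G \<phi>\<close>, and its transpose
  \<open>t = G \<epsilon> \<circ> \<kappa> U : \<phi> U \<rightarrow> G\<close> is a morphism of comonads.  The key fact is the general one that \<open>K\<close>
  is an equivalence if and only if \<open>\<phi>\<close> is comonadic and every component of \<open>t\<close> is invertible.  If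
  \<open>t\<close> is invertible, it identifies the coalgebras of \<open>\<phi> U\<close> with those of \<open>G\<close> and the comparison
  functor with \<open>K\<close>.  Conversely, if \<open>K\<close> is an equivalence, the cofree coalgebra on \<open>Y\<close> is
  isomorphic to some \<open>K W\<close>; transposing the isomorphism factors it through \<open>t\<close> at \<open>Y\<close>, which
  gives a right inverse, and fullness of \<open>K\<close> shows that it is a left inverse as well.

  For a grouplike \<open>g\<close>, the component of \<open>t\<close> at an algebra \<open>(A, h)\<close> is
  \<open>(h \<otimes> T g) \<circ> \<chi>\<close>, that is, \<open>A \<otimes> T g\<close> after the map \<open>(h \<otimes> T \<I>) \<circ> \<chi>\<close> which
  belongs to the trivial comonoid.  Three observations finish the proof.
  \<^item> At the unit algebra \<open>(\<I>, \<theta>)\<close> the component of \<open>t\<close> is \<open>T g\<close> itself.  So if \<open>K\<close> is an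
    equivalence then \<open>\<phi> g\<close> is invertible, and a comonadic functor reflects isomorphisms.
  \<^item> Once \<open>g\<close> is invertible, the map for \<open>g\<close> is invertible exactly when the map for the trivial
    comonoid is.
  \<^item> The map for the trivial comonoid at the free algebras is the Galois map.  Every algebra is a
    split coequalizer of free ones in \<open>V\<close>, so invertibility there suffices.
\<close>

section \<open>Composition without explicit hom-sets\<close>

text \<open>
  Stating composability through \<open>Dom\<close> and \<open>Cod\<close> rather than through membership in hom-sets
  leaves no unknown objects in the side conditions, so that the simplifier can discharge them.
\<close>

context category
begin

lemma comp_Arr [simp]: "\<lbrakk>f \<in> Arr C; g \<in> Arr C; Dom C g = Cod C f\<rbrakk> \<Longrightarrow> g \<cdot> f \<in> Arr C"
  and Dom_comp [simp]: "\<lbrakk>f \<in> Arr C; g \<in> Arr C; Dom C g = Cod C f\<rbrakk> \<Longrightarrow> Dom C (g \<cdot> f) = Dom C f"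
  and Cod_comp [simp]: "\<lbrakk>f \<in> Arr C; g \<in> Arr C; Dom C g = Cod C f\<rbrakk> \<Longrightarrow> Cod C (g \<cdot> f) = Cod C g"
  using compose_in[of f "Dom C f" "Cod C f" g "Cod C g"] by (auto simp: hom_def)

lemma ident_Arr [simp]: "A \<in> Obj C \<Longrightarrow> ident C A \<in> Arr C"
  and Dom_ident [simp]: "A \<in> Obj C \<Longrightarrow> Dom C (ident C A) = A"
  and Cod_ident [simp]: "A \<in> Obj C \<Longrightarrow> Cod C (ident C A) = A"
  using ident_in[of A] by (auto simp: hom_def)

lemma comp_ident_left [simp]: "\<lbrakk>f \<in> Arr C; Cod C f = B\<rbrakk> \<Longrightarrow> ident C B \<cdot> f = f"
  using ident_left[of f "Dom C f" B] by (auto simp: hom_def)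

lemma comp_ident_right [simp]: "\<lbrakk>f \<in> Arr C; Dom C f = A\<rbrakk> \<Longrightarrow> f \<cdot> ident C A = f"
  using ident_right[of f A "Cod C f"] by (auto simp: hom_def)

lemma comp_assoc:
  "\<lbrakk>f \<in> Arr C; g \<in> Arr C; h \<in> Arr C; Dom C g = Cod C f; Dom C h = Cod C g\<rbrakk>
    \<Longrightarrow> (h \<cdot> g) \<cdot> f = h \<cdot> (g \<cdot> f)"
  using compose_assoc[of f "Dom C f" "Cod C f" g "Cod C g" h "Cod C h"] by (auto simp: hom_def)

lemma Dom_Obj [simp]: "f \<in> Arr C \<Longrightarrow> Dom C f \<in> Obj C"
  and Cod_Obj [simp]: "f \<in> Arr C \<Longrightarrow> Cod C f \<in> Obj C"
  by (auto intro: Dom_in Cod_in)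

lemma is_isoI:
  "\<lbrakk>f \<in> hom C A B; g \<in> hom C B A; g \<cdot> f = ident C A; f \<cdot> g = ident C B\<rbrakk> \<Longrightarrow> is_iso C f"
  by (auto simp: is_iso_def hom_def)

lemma is_isoE:
  assumes "is_iso C f" "f \<in> hom C A B"
  obtains g where "g \<in> hom C B A" "g \<cdot> f = ident C A" "f \<cdot> g = ident C B"
  using assms by (auto simp: is_iso_def hom_def)

lemma iso_comp:
  assumes f: "is_iso C f" "f \<in> hom C A B" and g: "is_iso C g" "g \<in> hom C B D"
  shows "is_iso C (g \<cdot> f)"
proof -
  obtain f' where f': "f' \<in> hom C B A" "f' \<cdot> f = ident C A" "f \<cdot> f' = ident C B"
    using f by (rule is_isoE)
  obtain g' where g': "g' \<in> hom C D B" "g' \<cdot> g = ident C B" "g \<cdot> g' = ident C D"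
    using g by (rule is_isoE)
  have "(f' \<cdot> g') \<cdot> (g \<cdot> f) = f' \<cdot> ((g' \<cdot> g) \<cdot> f)"
    using f g f'(1) g'(1) by (simp add: hom_def comp_assoc)
  moreover have "(g \<cdot> f) \<cdot> (f' \<cdot> g') = g \<cdot> ((f \<cdot> f') \<cdot> g')"
    using f g f'(1) g'(1) by (simp add: hom_def comp_assoc)
  ultimately show ?thesis
    using f g f' g' by (intro is_isoI[of _ A D "f' \<cdot> g'"]) (auto simp: hom_def)
qed

lemma iso_cancel_left:
  assumes g: "is_iso C g" "g \<in> hom C B D" and f: "f \<in> hom C A B" and gf: "is_iso C (g \<cdot> f)"
  shows "is_iso C f"
proof -
  obtain g' where g': "g' \<in> hom C D B" "g' \<cdot> g = ident C B" "g \<cdot> g' = ident C D"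
    using g by (rule is_isoE)
  have "is_iso C (g' \<cdot> (g \<cdot> f))"
    by (rule iso_comp[OF gf _ _ g'(1)])
      (use f g g' in \<open>auto intro!: is_isoI[of g' D B g] simp: hom_def\<close>)
  moreover have "g' \<cdot> (g \<cdot> f) = f"
    using f g g' by (simp add: hom_def flip: comp_assoc)
  ultimately show ?thesis by simp
qed

lemma iso_monic:
  assumes i: "is_iso C i" "i \<in> hom C B D" and "f \<in> hom C A B" "g \<in> hom C A B" and eq: "i \<cdot> f = i \<cdot> g"
  shows "f = g"
proof -
  obtain j where j: "j \<in> hom C D B" "j \<cdot> i = ident C B"
    using i by (rule is_isoE)
  have "(j \<cdot> i) \<cdot> f = (j \<cdot> i) \<cdot> g"
    using assms j(1) by (simp add: hom_def comp_assoc)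
  then show ?thesis
    using assms(2-4) j by (simp add: hom_def)
qed

lemma iso_epic:
  assumes i: "is_iso C i" "i \<in> hom C A B" and "f \<in> hom C B D" "g \<in> hom C B D" and eq: "f \<cdot> i = g \<cdot> i"
  shows "f = g"
proof -
  obtain j where j: "j \<in> hom C B A" "i \<cdot> j = ident C B"
    using i by (rule is_isoE)
  have "f \<cdot> (i \<cdot> j) = g \<cdot> (i \<cdot> j)"
    using assms j(1) by (simp add: hom_def flip: comp_assoc)
  then show ?thesis
    using assms(2-4) j by (simp add: hom_def)
qed

end

context cfunctor
begin

lemma farr_Arr [simp]: "f \<in> Arr C \<Longrightarrow> farr F f \<in> Arr D"
  and Dom_farr [simp]: "f \<in> Arr C \<Longrightarrow> Dom D (farr F f) = fob F (Dom C f)"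
  and Cod_farr [simp]: "f \<in> Arr C \<Longrightarrow> Cod D (farr F f) = fob F (Cod C f)"
  using farr_in[of f "Dom C f" "Cod C f"] by (auto simp: hom_def)

lemma farr_comp:
  "\<lbrakk>f \<in> Arr C; g \<in> Arr C; Dom C g = Cod C f\<rbrakk> \<Longrightarrow>
    farr F (g \<cdot>\<^bsub>C\<^esub> f) = farr F g \<cdot>\<^bsub>D\<^esub> farr F f"
  using farr_compose[of f "Dom C f" "Cod C f" g "Cod C g"] by (auto simp: hom_def)

lemmas fob_Obj [simp] = fob_in
lemmas farr_ident_simp [simp] = farr_ident

lemma preserves_iso:
  assumes "is_iso C f"
  shows "is_iso D (farr F f)"
proof -
  have f: "f \<in> hom C (Dom C f) (Cod C f)"
    using assms by (simp add: is_iso_def hom_def)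
  obtain g where g: "g \<in> hom C (Cod C f) (Dom C f)"
      "g \<cdot>\<^bsub>C\<^esub> f = ident C (Dom C f)" "f \<cdot>\<^bsub>C\<^esub> g = ident C (Cod C f)"
    using source.is_isoE[OF assms f] .
  show ?thesis
    by (rule target.is_isoI[OF farr_in[OF f] farr_in[OF g(1)]])
      (use f g in \<open>auto simp: hom_def simp flip: farr_comp\<close>)
qed

end

lemma nat_trans_in: "nat_trans C D F G t \<Longrightarrow> A \<in> Obj C \<Longrightarrow> t A \<in> hom D (fob F A) (fob G A)"
  by (simp add: nat_trans_def)

lemma nat_trans_naturality:
  assumes "nat_trans C D F G t" "category C" "f \<in> Arr C" 
  shows "t (Cod C f) \<cdot>\<^bsub>D\<^esub> farr F f = farr G f \<cdot>\<^bsub>D\<^esub> t (Dom C f)"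
proof -
  interpret category C by fact
  show ?thesis
    using assms by (auto simp: nat_trans_def hom_def)
qed


section \<open>Equivalences of categories\<close>

text \<open>
  For an equivalence with quasi-inverse \<open>G\<close> and unit \<open>\<eta>\<close>, the square \<open>\<eta> \<circ> u = G F u \<circ> \<eta>\<close>
  recovers \<open>u\<close> from \<open>F u\<close>.  The same argument for the counit makes \<open>G\<close> faithful, and the arrow
  \<open>\<eta>\<^sup>-\<^sup>1 \<circ> G f \<circ> \<eta>\<close> is then a preimage of \<open>f\<close> because \<open>G\<close> cannot tell its image from \<open>f\<close>.
\<close>

lemma equivalence_faithful_on_hom:
  assumes C: "category C" and F: "cfunctor C D F" and G: "cfunctor D C G"
    and \<eta>: "nat_iso C C id_functor (comp_functor G F) \<eta>"
    and u: "u \<in> hom C A B" and v: "v \<in> hom C A B" and eq: "farr F u = farr F v"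
  shows "u = v"
proof -
  interpret F: cfunctor C D F by fact
  interpret G: cfunctor D C G by fact
  have AB: "A \<in> Obj C" "B \<in> Obj C"
    using u by (auto simp: hom_def)
  have sq: "\<eta> B \<cdot>\<^bsub>C\<^esub> w = farr G (farr F w) \<cdot>\<^bsub>C\<^esub> \<eta> A" if "w \<in> hom C A B" for w
    using \<eta> AB that by (auto simp: nat_iso_def nat_trans_def id_functor_def comp_functor_def)
  have "is_iso C (\<eta> B)" "\<eta> B \<in> hom C B (fob G (fob F B))"
    using \<eta> AB by (auto simp: nat_iso_def nat_trans_def id_functor_def comp_functor_def)
  then show ?thesis
    using F.source.iso_monic[of "\<eta> B" B _ u A v] u v sq[OF u] sq[OF v] eq by simp
qed

lemma quasi_inverse_faithful:
  assumes C: "category D" and F: "cfunctor C D F" and G: "cfunctor D C G"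
    and \<epsilon>: "nat_iso D D (comp_functor F G) id_functor \<epsilon>"
    and u: "u \<in> hom D A B" and v: "v \<in> hom D A B" and eq: "farr G u = farr G v"
  shows "u = v"
proof -
  interpret F: cfunctor C D F by fact
  interpret G: cfunctor D C G by fact
  have AB: "A \<in> Obj D" "B \<in> Obj D"
    using u by (auto simp: hom_def)
  have sq: "\<epsilon> B \<cdot>\<^bsub>D\<^esub> farr F (farr G w) = w \<cdot>\<^bsub>D\<^esub> \<epsilon> A" if "w \<in> hom D A B" for w
    using \<epsilon> AB that by (auto simp: nat_iso_def nat_trans_def id_functor_def comp_functor_def)
  have "is_iso D (\<epsilon> A)" "\<epsilon> A \<in> hom D (fob F (fob G A)) A"
    using \<epsilon> AB by (auto simp: nat_iso_def nat_trans_def id_functor_def comp_functor_def)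
  then show ?thesis
    using F.target.iso_epic[of "\<epsilon> A" _ A u B v] u v sq[OF u] sq[OF v] eq by simp
qed

lemma equivalence_full_faithful_eso:
  fixes C :: "('o, 'a, 'm) category_scheme" and D :: "('p, 'b, 'n) category_scheme"
  assumes "equivalence_of_categories C D F"
  shows equivalence_inj: "\<And>A B u v. \<lbrakk>u \<in> hom C A B; v \<in> hom C A B; farr F u = farr F v\<rbrakk> \<Longrightarrow> u = v"
    and equivalence_full: "\<And>A B f. \<lbrakk>A \<in> Obj C; B \<in> Obj C; f \<in> hom D (fob F A) (fob F B)\<rbrakk>
      \<Longrightarrow> \<exists>u \<in> hom C A B. farr F u = f"
    and equivalence_eso: "\<And>X. X \<in> Obj D \<Longrightarrow> \<exists>A \<in> Obj C. \<exists>i \<in> hom D (fob F A) X. is_iso D i"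
proof -
  obtain G :: "('p, 'b, 'o, 'a) cfunctor" and \<eta> \<epsilon> where F: "cfunctor C D F" and G: "cfunctor D C G"
    and \<eta>: "nat_iso C C id_functor (comp_functor G F) \<eta>"
    and \<epsilon>: "nat_iso D D (comp_functor F G) id_functor \<epsilon>"
    using assms by (auto simp: equivalence_of_categories_def)
  interpret F: cfunctor C D F by fact
  interpret G: cfunctor D C G by fact
  have cat: "category C" "category D" by unfold_locales
  show inj: "u = v" if "u \<in> hom C A B" "v \<in> hom C A B" "farr F u = farr F v" for A B u v
    using equivalence_faithful_on_hom[OF cat(1) F G \<eta>] that by blast
  show "\<exists>A \<in> Obj C. \<exists>i \<in> hom D (fob F A) X. is_iso D i" if "X \<in> Obj D" for X
    using \<epsilon> that
    by (intro bexI[of _ "fob G X"] bexI[of _ "\<epsilon> X"])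
      (auto simp: nat_iso_def nat_trans_def id_functor_def comp_functor_def)
  show "\<exists>u \<in> hom C A B. farr F u = f"
    if A: "A \<in> Obj C" and B: "B \<in> Obj C" and f: "f \<in> hom D (fob F A) (fob F B)" for A B f
  proof -
    have \<eta>A: "is_iso C (\<eta> A)" "\<eta> A \<in> hom C A (fob G (fob F A))"
      and \<eta>B: "is_iso C (\<eta> B)" "\<eta> B \<in> hom C B (fob G (fob F B))"
      using \<eta> A B by (auto simp: nat_iso_def nat_trans_def id_functor_def comp_functor_def)
    obtain j where j: "j \<in> hom C (fob G (fob F B)) B" "\<eta> B \<cdot>\<^bsub>C\<^esub> j = ident C (fob G (fob F B))"
      using F.source.is_isoE[OF \<eta>B] by blast
    define u where "u = j \<cdot>\<^bsub>C\<^esub> (farr G f \<cdot>\<^bsub>C\<^esub> \<eta> A)"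
    have u: "u \<in> hom C A B"
      using j \<eta>A f by (auto simp: u_def hom_def)
    have "farr G (farr F u) \<cdot>\<^bsub>C\<^esub> \<eta> A = \<eta> B \<cdot>\<^bsub>C\<^esub> u"
      using \<eta> A B u by (auto simp: nat_iso_def nat_trans_def id_functor_def comp_functor_def)
    also have "\<dots> = (\<eta> B \<cdot>\<^bsub>C\<^esub> j) \<cdot>\<^bsub>C\<^esub> (farr G f \<cdot>\<^bsub>C\<^esub> \<eta> A)"
      using j(1) \<eta>A \<eta>B f by (simp add: u_def hom_def F.source.comp_assoc)
    also have "\<dots> = farr G f \<cdot>\<^bsub>C\<^esub> \<eta> A"
      using j \<eta>A f by (simp add: hom_def)
    finally have "farr G (farr F u) = farr G f"
      using F.source.iso_epic[OF \<eta>A, of "farr G (farr F u)" "fob G (fob F B)" "farr G f"] u f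
      by (auto simp: hom_def)
    then have "farr F u = f"
      using quasi_inverse_faithful[OF cat(2) F G \<epsilon>] F.farr_in[OF u] f by blast
    then show ?thesis using u by blast
  qed
qed

text \<open>
  Transport along an isomorphism of categories \<open>\<Phi>\<close> with inverse \<open>\<Psi>\<close>: if \<open>G\<close> is a quasi-inverse of
  \<open>F\<close>, then \<open>G \<Psi>\<close> is one of \<open>\<Phi> F\<close>.
  Equality of \<open>K\<close> with \<open>\<Phi> F\<close> is only asked on the objects and arrows of \<open>C\<close>, since functors are
  unconstrained elsewhere.
\<close>

lemma equivalence_transport:
  fixes C :: "('o, 'a, 'm) category_scheme" and D :: "('p, 'b, 'n) category_scheme"
  assumes F: "equivalence_of_categories C D F"
    and \<Phi>: "cfunctor D E \<Phi>" and \<Psi>: "cfunctor E D \<Psi>"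
    and ob: "\<And>X. X \<in> Obj D \<Longrightarrow> fob \<Psi> (fob \<Phi> X) = X" "\<And>X. X \<in> Obj E \<Longrightarrow> fob \<Phi> (fob \<Psi> X) = X"
    and arr: "\<And>f. f \<in> Arr D \<Longrightarrow> farr \<Psi> (farr \<Phi> f) = f" "\<And>f. f \<in> Arr E \<Longrightarrow> farr \<Phi> (farr \<Psi> f) = f"
    and Kob: "\<And>A. A \<in> Obj C \<Longrightarrow> fob K A = fob \<Phi> (fob F A)"
    and Karr: "\<And>f. f \<in> Arr C \<Longrightarrow> farr K f = farr \<Phi> (farr F f)"
  shows "equivalence_of_categories C E K"
proof -
  obtain G :: "('p, 'b, 'o, 'a) cfunctor" and \<eta> \<epsilon> where F: "cfunctor C D F" and G: "cfunctor D C G"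
    and \<eta>: "nat_iso C C id_functor (comp_functor G F) \<eta>"
    and \<epsilon>: "nat_iso D D (comp_functor F G) id_functor \<epsilon>"
    using assms by (auto simp: equivalence_of_categories_def)
  interpret F: cfunctor C D F by fact
  interpret G: cfunctor D C G by fact
  interpret \<Phi>: cfunctor D E \<Phi> by fact
  interpret \<Psi>: cfunctor E D \<Psi> by fact
  have \<epsilon>_in: "\<epsilon> X \<in> hom D (fob F (fob G X)) X" "is_iso D (\<epsilon> X)" if "X \<in> Obj D" for X
    using \<epsilon> that by (auto simp: nat_iso_def nat_trans_def id_functor_def comp_functor_def)
  have "cfunctor C E K"
    by unfold_locales
      (auto simp: Kob Karr hom_def F.farr_comp \<Phi>.farr_comp)
  moreover have "cfunctor E C (comp_functor G \<Psi>)"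
    by unfold_locales
      (auto simp: comp_functor_def hom_def G.farr_comp \<Psi>.farr_comp)
  moreover have "nat_iso C C id_functor (comp_functor (comp_functor G \<Psi>) K) \<eta>"
    using \<eta> 
    by (auto simp: nat_iso_def nat_trans_def id_functor_def comp_functor_def hom_def Kob Karr ob arr)
  moreover have "nat_iso E E (comp_functor K (comp_functor G \<Psi>)) id_functor (\<lambda>X. farr \<Phi> (\<epsilon> (fob \<Psi> X)))"
    unfolding nat_iso_def nat_trans_def
  proof (intro conjI ballI)
    fix X assume X: "X \<in> Obj E"
    show "farr \<Phi> (\<epsilon> (fob \<Psi> X)) \<in> hom E (fob (comp_functor K (comp_functor G \<Psi>)) X) (fob id_functor X)"
      using \<epsilon>_in(1)[of "fob \<Psi> X"] X
      by (auto simp: comp_functor_def id_functor_def Kob ob hom_def)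
    show "is_iso E (farr \<Phi> (\<epsilon> (fob \<Psi> X)))"
      using \<epsilon>_in(2)[of "fob \<Psi> X"] X by (simp add: \<Phi>.preserves_iso)
  next
    fix X Y f assume XY: "X \<in> Obj E" "Y \<in> Obj E" and f: "f \<in> hom E X Y"
    have "\<epsilon> (fob \<Psi> Y) \<cdot>\<^bsub>D\<^esub> farr F (farr G (farr \<Psi> f)) = farr \<Psi> f \<cdot>\<^bsub>D\<^esub> \<epsilon> (fob \<Psi> X)"
      using \<epsilon> XY f \<Psi>.farr_in[OF f]
      by (auto simp: nat_iso_def nat_trans_def id_functor_def comp_functor_def)
    then have "farr \<Phi> (\<epsilon> (fob \<Psi> Y) \<cdot>\<^bsub>D\<^esub> farr F (farr G (farr \<Psi> f)))
        = farr \<Phi> (farr \<Psi> f \<cdot>\<^bsub>D\<^esub> \<epsilon> (fob \<Psi> X))"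
      by simp
    then show "farr \<Phi> (\<epsilon> (fob \<Psi> Y)) \<cdot>\<^bsub>E\<^esub> farr (comp_functor K (comp_functor G \<Psi>)) f
        = farr id_functor f \<cdot>\<^bsub>E\<^esub> farr \<Phi> (\<epsilon> (fob \<Psi> X))"
      using f XY \<epsilon>_in(1)[of "fob \<Psi> X"] \<epsilon>_in(1)[of "fob \<Psi> Y"]
      by (auto simp: comp_functor_def id_functor_def Karr arr hom_def \<Phi>.farr_comp)
  qed
  ultimately show ?thesis
    by (auto simp: equivalence_of_categories_def)
qed


section \<open>Comonads and their coalgebras\<close>

lemma structured_category_simps [simp]:
  "Obj (structured_category C P Q) = {X. P X}"
  "Dom (structured_category C P Q) (X, f, Y) = X"
  "Cod (structured_category C P Q) (X, f, Y) = Y"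
  "ident (structured_category C P Q) X = (X, ident C (fst X), X)"
  "compose (structured_category C P Q) (Y', g, Z) (X, f, Y) = (X, g \<cdot>\<^bsub>C\<^esub> f, Z)"
  "(X, f, Y) \<in> Arr (structured_category C P Q) \<longleftrightarrow>
    P X \<and> P Y \<and> f \<in> hom C (fst X) (fst Y) \<and> Q X f Y"
  by (auto simp: structured_category_def)

lemma in_hom_structured_category:
  "k \<in> hom (structured_category C P Q) X Y \<longleftrightarrow>
    (\<exists>f. k = (X, f, Y) \<and> P X \<and> P Y \<and> f \<in> hom C (fst X) (fst Y) \<and> Q X f Y)"
  by (cases k) (auto simp: hom_def structured_category_def)

lemma category_structured_category:
  assumes "category C"
    and "\<And>X. P X \<Longrightarrow> fst X \<in> Obj C"
    and "\<And>X. P X \<Longrightarrow> Q X (ident C (fst X)) X"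
    and "\<And>X Y Z f g. \<lbrakk>P X; P Y; P Z; f \<in> hom C (fst X) (fst Y); g \<in> hom C (fst Y) (fst Z);
      Q X f Y; Q Y g Z\<rbrakk> \<Longrightarrow> Q X (g \<cdot>\<^bsub>C\<^esub> f) Z"
  shows "category (structured_category C P Q)"
proof -
  interpret category C by fact
  let ?S = "structured_category C P Q"
  show ?thesis
  proof (rule category.intro)
    fix X Y Z k l
    assume "k \<in> hom ?S X Y" and "l \<in> hom ?S Y Z"
    then obtain f g where kl: "k = (X, f, Y)" "l = (Y, g, Z)" "P X" "P Y" "P Z"
      "f \<in> hom C (fst X) (fst Y)" "g \<in> hom C (fst Y) (fst Z)" "Q X f Y" "Q Y g Z"
      by (auto simp: in_hom_structured_category)
    then show "compose ?S l k \<in> hom ?S X Z"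
      using assms(4)[of X Y Z f g] compose_in[of f _ _ g] by (simp add: in_hom_structured_category)
    fix W m assume "m \<in> hom ?S Z W"
    then obtain h where "m = (Z, h, W)" "h \<in> hom C (fst Z) (fst W)"
      by (auto simp: in_hom_structured_category)
    with kl show "compose ?S (compose ?S m l) k = compose ?S m (compose ?S l k)"
      using compose_assoc[of f _ _ g _ h] by simp
  next
    fix k assume "k \<in> Arr ?S"
    then show "Dom ?S k \<in> Obj ?S" "Cod ?S k \<in> Obj ?S"
      by (cases k, simp)+
  next
    fix X assume "X \<in> Obj ?S"
    then show "ident ?S X \<in> hom ?S X X"
      using assms(2,3)[of X] by (simp add: in_hom_structured_category ident_in)
  next
    fix X Y k assume "k \<in> hom ?S X Y"
    then obtain f where "k = (X, f, Y)" "f \<in> hom C (fst X) (fst Y)"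
      by (auto simp: in_hom_structured_category)
    then show "compose ?S (ident ?S Y) k = k" "compose ?S k (ident ?S X) = k"
      by (simp_all add: ident_left ident_right)
  qed
qed

lemma coalgebra_category_simps [simp]:
  "Obj (coalgebra_category C G) = {X. is_coalgebra C G X}"
  "Dom (coalgebra_category C G) (X, f, Y) = X"
  "Cod (coalgebra_category C G) (X, f, Y) = Y"
  "ident (coalgebra_category C G) X = (X, ident C (fst X), X)"
  "compose (coalgebra_category C G) (Y', g, Z) (X, f, Y) = (X, g \<cdot>\<^bsub>C\<^esub> f, Z)"
  "(X, f, Y) \<in> Arr (coalgebra_category C G) \<longleftrightarrow>
    is_coalgebra C G X \<and> is_coalgebra C G Y \<and> f \<in> hom C (fst X) (fst Y) \<and>
    snd Y \<cdot>\<^bsub>C\<^esub> f = farr G f \<cdot>\<^bsub>C\<^esub> snd X"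
  by (auto simp: coalgebra_category_def split: prod.splits)

lemma in_hom_coalgebra_category:
  "k \<in> hom (coalgebra_category C G) X Y \<longleftrightarrow>
    (\<exists>f. k = (X, f, Y) \<and> is_coalgebra C G X \<and> is_coalgebra C G Y \<and> f \<in> hom C (fst X) (fst Y) \<and>
      snd Y \<cdot>\<^bsub>C\<^esub> f = farr G f \<cdot>\<^bsub>C\<^esub> snd X)"
  by (cases X; cases Y) (auto simp: coalgebra_category_def in_hom_structured_category)

lemma category_coalgebra_category:
  assumes "cfunctor C C G"
  shows "category (coalgebra_category C G)"
proof -
  interpret cfunctor C C G by fact
  have comp: "c \<cdot>\<^bsub>C\<^esub> (g \<cdot>\<^bsub>C\<^esub> f) = farr G (g \<cdot>\<^bsub>C\<^esub> f) \<cdot>\<^bsub>C\<^esub> a"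
    if f: "f \<in> hom C A B" and g: "g \<in> hom C B D"
      and a: "a \<in> hom C A (fob G A)" and b: "b \<in> hom C B (fob G B)" and c: "c \<in> hom C D (fob G D)"
      and fa: "b \<cdot>\<^bsub>C\<^esub> f = farr G f \<cdot>\<^bsub>C\<^esub> a" and gb: "c \<cdot>\<^bsub>C\<^esub> g = farr G g \<cdot>\<^bsub>C\<^esub> b"
    for A B D a b c f g
  proof -
    have "c \<cdot>\<^bsub>C\<^esub> (g \<cdot>\<^bsub>C\<^esub> f) = farr G g \<cdot>\<^bsub>C\<^esub> (b \<cdot>\<^bsub>C\<^esub> f)"
      using f g b c gb by (simp add: hom_def flip: source.comp_assoc)
    then show ?thesis
      using f g a fa by (simp add: hom_def farr_comp source.comp_assoc)
  qed
  show ?thesis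
    unfolding coalgebra_category_def
    by (rule category_structured_category)
      (auto simp: is_coalgebra_def hom_def intro: source.category_axioms comp split: prod.splits)
qed

locale comonad = cfunctor C C G for C (structure) and G +
  assumes comult_nat: "nat_trans C C G (comp_functor G G) (comult G)"
    and counit_nat: "nat_trans C C G id_functor (counit G)"
    and comult_coassoc:
      "A \<in> Obj C \<Longrightarrow> comult G (fob G A) \<cdot> comult G A = farr G (comult G A) \<cdot> comult G A"
    and counit_left: "A \<in> Obj C \<Longrightarrow> counit G (fob G A) \<cdot> comult G A = ident C (fob G A)"
    and counit_right: "A \<in> Obj C \<Longrightarrow> farr G (counit G A) \<cdot> comult G A = ident C (fob G A)"
begin

lemma comult_hom [simp]:
  "A \<in> Obj C \<Longrightarrow> comult G A \<in> Arr C"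
  "A \<in> Obj C \<Longrightarrow> Dom C (comult G A) = fob G A"
  "A \<in> Obj C \<Longrightarrow> Cod C (comult G A) = fob G (fob G A)"
  using nat_trans_in[OF comult_nat, of A] by (auto simp: hom_def comp_functor_def)

lemma counit_hom [simp]:
  "A \<in> Obj C \<Longrightarrow> counit G A \<in> Arr C"
  "A \<in> Obj C \<Longrightarrow> Dom C (counit G A) = fob G A"
  "A \<in> Obj C \<Longrightarrow> Cod C (counit G A) = A"
  using nat_trans_in[OF counit_nat, of A] by (auto simp: hom_def id_functor_def)

lemma comult_naturality:
  "f \<in> Arr C \<Longrightarrow> comult G (Cod C f) \<cdot> farr G f = farr G (farr G f) \<cdot> comult G (Dom C f)"
  using nat_trans_naturality[OF comult_nat] source.category_axioms by (simp add: comp_functor_def)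

lemma counit_naturality:
  "f \<in> Arr C \<Longrightarrow> counit G (Cod C f) \<cdot> farr G f = f \<cdot> counit G (Dom C f)"
  using nat_trans_naturality[OF counit_nat] source.category_axioms by (simp add: id_functor_def)

lemma cofree_coalgebra: "A \<in> Obj C \<Longrightarrow> is_coalgebra C G (fob G A, comult G A)"
  by (simp add: is_coalgebra_def hom_def comult_coassoc counit_left)

end

locale comonad_morphism = H: comonad C H + G: comonad C G for C (structure) and H and G +
  fixes t
  assumes t_nat: "nat_trans C C H G t"
    and t_counit: "A \<in> Obj C \<Longrightarrow> counit G A \<cdot> t A = counit H A"
    and t_comult: "A \<in> Obj C \<Longrightarrow> comult G A \<cdot> t A = farr G (t A) \<cdot> (t (fob H A) \<cdot> comult H A)"
begin

lemma t_hom [simp]: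
  "A \<in> Obj C \<Longrightarrow> t A \<in> Arr C"
  "A \<in> Obj C \<Longrightarrow> Dom C (t A) = fob H A"
  "A \<in> Obj C \<Longrightarrow> Cod C (t A) = fob G A"
  using nat_trans_in[OF t_nat, of A] by (auto simp: hom_def)

lemma t_naturality: "f \<in> Arr C \<Longrightarrow> t (Cod C f) \<cdot> farr H f = farr G f \<cdot> t (Dom C f)"
  using nat_trans_naturality[OF t_nat] H.source.category_axioms by simp

text \<open>
  A morphism \<open>t : H \<rightarrow> G\<close> of comonads turns an \<open>H\<close>-coalgebra \<open>a\<close> into the \<open>G\<close>-coalgebra \<open>t \<circ> a\<close>
  and leaves the underlying arrows of coalgebra morphisms alone.  The type constraint gives the
  arrows of source and target the same type.
\<close>

definition push_ob where "push_ob = (\<lambda>(A, a). (A, t A \<cdot> a))"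

definition pushforward where
  "pushforward = \<lparr>fob = push_ob, farr = (\<lambda>(X, f :: 'b, Y). (push_ob X, f, push_ob Y))\<rparr>"

lemma push_ob_coalgebra:
  assumes "is_coalgebra C H X"
  shows "is_coalgebra C G (push_ob X)"
proof -
  obtain A a where X: "X = (A, a)" by (cases X)
  have [simp]: "A \<in> Obj C" "a \<in> Arr C" "Dom C a = A" "Cod C a = fob H A"
    and a: "comult H A \<cdot> a = farr H a \<cdot> a" "counit H A \<cdot> a = ident C A"
    using assms by (auto simp: X is_coalgebra_def hom_def)
  have "comult G A \<cdot> (t A \<cdot> a) = (comult G A \<cdot> t A) \<cdot> a"
    by (simp add: H.source.comp_assoc)
  also have "\<dots> = farr G (t A) \<cdot> (t (fob H A) \<cdot> (comult H A \<cdot> a))"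
    by (simp add: t_comult H.source.comp_assoc)
  also have "\<dots> = farr G (t A) \<cdot> ((t (fob H A) \<cdot> farr H a) \<cdot> a)"
    by (simp add: a H.source.comp_assoc)
  also have "\<dots> = farr G (t A \<cdot> a) \<cdot> (t A \<cdot> a)"
    using t_naturality[of a] by (simp add: G.farr_comp H.source.comp_assoc)
  finally have "comult G A \<cdot> (t A \<cdot> a) = farr G (t A \<cdot> a) \<cdot> (t A \<cdot> a)" .
  moreover have "counit G A \<cdot> (t A \<cdot> a) = ident C A"
    using a by (simp add: t_counit flip: H.source.comp_assoc)
  ultimately show ?thesis
    by (simp add: X push_ob_def is_coalgebra_def hom_def)
qed

lemma pushforward_cfunctor: "cfunctor (coalgebra_category C H) (coalgebra_category C G) pushforward"
proof -
  have sq: "(t B \<cdot> b) \<cdot> f = farr G f \<cdot> (t A \<cdot> a)"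
    if f: "f \<in> hom C A B" and a: "a \<in> hom C A (fob H A)" and b: "b \<in> hom C B (fob H B)"
      and "b \<cdot> f = farr H f \<cdot> a" for A B a b f
  proof -
    have "(t B \<cdot> b) \<cdot> f = (t B \<cdot> farr H f) \<cdot> a"
      using that by (auto simp: hom_def H.source.comp_assoc)
    also have "t B \<cdot> farr H f = farr G f \<cdot> t A"
      using f t_naturality[of f] by (auto simp: hom_def)
    finally show ?thesis
      using f a by (auto simp: hom_def H.source.comp_assoc)
  qed
  show ?thesis
  proof (intro cfunctor.intro cfunctor_axioms.intro)
    fix X assume "X \<in> Obj (coalgebra_category C H)"
    then show "fob pushforward X \<in> Obj (coalgebra_category C G)"
      by (simp add: pushforward_def push_ob_coalgebra)
  next
    fix X Y k assume "k \<in> hom (coalgebra_category C H) X Y"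
    then show "farr pushforward k \<in> hom (coalgebra_category C G) (fob pushforward X) (fob pushforward Y)"
      by (auto simp: pushforward_def in_hom_coalgebra_category push_ob_coalgebra)
        (auto simp: push_ob_def is_coalgebra_def intro: sq)
  qed (auto simp: pushforward_def push_ob_def in_hom_coalgebra_category
      intro: category_coalgebra_category H.cfunctor_axioms G.cfunctor_axioms)
qed

text \<open>
  The inverse inherits naturality and compatibility with the comonad structures, each by inserting
  \<open>t \<circ> s = 1\<close> and moving \<open>t\<close> across the corresponding equation for \<open>t\<close>.
\<close>

lemma inverse_comonad_morphism:
  assumes s: "\<And>A. A \<in> Obj C \<Longrightarrow> s A \<in> hom C (fob G A) (fob H A)"
    and st: "\<And>A. A \<in> Obj C \<Longrightarrow> s A \<cdot> t A = ident C (fob H A)"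
    and ts: "\<And>A. A \<in> Obj C \<Longrightarrow> t A \<cdot> s A = ident C (fob G A)"
  shows "comonad_morphism C G H s"
proof -
  have [simp]: "s A \<in> Arr C" "Dom C (s A) = fob G A" "Cod C (s A) = fob H A" if "A \<in> Obj C" for A
    using s[OF that] by (auto simp: hom_def)
  have nat: "s (Cod C f) \<cdot> farr G f = farr H f \<cdot> s (Dom C f)" if [simp]: "f \<in> Arr C" for f
  proof -
    have "s (Cod C f) \<cdot> farr G f = s (Cod C f) \<cdot> ((farr G f \<cdot> t (Dom C f)) \<cdot> s (Dom C f))"
      by (simp add: H.source.comp_assoc ts)
    also have "\<dots> = (s (Cod C f) \<cdot> t (Cod C f)) \<cdot> (farr H f \<cdot> s (Dom C f))"
      by (simp add: H.source.comp_assoc flip: t_naturality)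
    finally show ?thesis by (simp add: st)
  qed
  show ?thesis
  proof
    show "nat_trans C C G H s"
      using nat s by (auto simp: nat_trans_def hom_def)
    fix A assume [simp]: "A \<in> Obj C"
    have "counit H A \<cdot> s A = counit G A \<cdot> (t A \<cdot> s A)"
      by (simp add: H.source.comp_assoc flip: t_counit)
    then show "counit H A \<cdot> s A = counit G A"
      by (simp add: ts)
    have "farr H (s A) \<cdot> (s (fob G A) \<cdot> comult G A)
        = farr H (s A) \<cdot> (s (fob G A) \<cdot> ((comult G A \<cdot> t A) \<cdot> s A))"
      by (simp add: H.source.comp_assoc ts)
    also have "\<dots> = farr H (s A) \<cdot> ((s (fob G A) \<cdot> farr G (t A)) \<cdot> (t (fob H A) \<cdot> (comult H A \<cdot> s A)))"
      by (simp add: t_comult H.source.comp_assoc)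
    also have "s (fob G A) \<cdot> farr G (t A) = farr H (t A) \<cdot> s (fob H A)"
      using nat[of "t A"] by simp
    also have "farr H (s A) \<cdot> ((farr H (t A) \<cdot> s (fob H A)) \<cdot> (t (fob H A) \<cdot> (comult H A \<cdot> s A)))
        = farr H (s A) \<cdot> (farr H (t A) \<cdot> ((s (fob H A) \<cdot> t (fob H A)) \<cdot> (comult H A \<cdot> s A)))"
      by (simp add: H.source.comp_assoc)
    also have "\<dots> = (farr H (s A) \<cdot> farr H (t A)) \<cdot> (comult H A \<cdot> s A)"
      by (simp add: st H.source.comp_assoc)
    also have "farr H (s A) \<cdot> farr H (t A) = ident C (fob H (fob H A))"
      by (simp add: st flip: H.farr_comp)
    finally show "comult H A \<cdot> s A = farr H (s A) \<cdot> (s (fob G A) \<cdot> comult G A)"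
      by simp
  qed
qed

end

lemma pushforward_inverse:
  assumes t: "comonad_morphism C H G t" and s: "comonad_morphism C G H s"
    and st: "\<And>A. A \<in> Obj C \<Longrightarrow> s A \<cdot>\<^bsub>C\<^esub> t A = ident C (fob H A)"
  shows "X \<in> Obj (coalgebra_category C H) \<Longrightarrow>
      fob (comonad_morphism.pushforward C s) (fob (comonad_morphism.pushforward C t) X) = X"
    and "k \<in> Arr (coalgebra_category C H) \<Longrightarrow>
      farr (comonad_morphism.pushforward C s) (farr (comonad_morphism.pushforward C t) k) = k"
proof -
  interpret t: comonad_morphism C H G t by fact
  interpret s: comonad_morphism C G H s by fact
  have ob: "s.push_ob (t.push_ob X) = X" if "is_coalgebra C H X" for X
    using that st
    by (auto simp: t.push_ob_def s.push_ob_def is_coalgebra_def hom_def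
        simp flip: t.H.source.comp_assoc)
  show "X \<in> Obj (coalgebra_category C H) \<Longrightarrow> fob s.pushforward (fob t.pushforward X) = X"
    by (simp add: t.pushforward_def s.pushforward_def ob)
  show "k \<in> Arr (coalgebra_category C H) \<Longrightarrow> farr s.pushforward (farr t.pushforward k) = k"
    by (cases k) (auto simp: t.pushforward_def s.pushforward_def ob)
qed


section \<open>Lifting a left adjoint through the coalgebras of a comonad\<close>

text \<open>
  The lift of \<open>F\<close> through the coalgebras of a comonad \<open>G\<close> that is determined by a natural coaction
  \<open>\<kappa> : F \<rightarrow> G F\<close>.  The comparison functor is the lift for \<open>G = F U\<close> and \<open>\<kappa> = F \<eta>\<close>.
\<close>

definition lift_functor where
  "lift_functor A F \<kappa> =
    (let K = (\<lambda>X. (fob F X, \<kappa> X))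
     in \<lparr>fob = K, farr = (\<lambda>f. (K (Dom A f), farr F f, K (Cod A f)))\<rparr>)"

lemma comparison_functor_eq_lift: "comparison_functor A F \<eta> = lift_functor A F (\<lambda>X. farr F (\<eta> X))"
  by (simp add: comparison_functor_def lift_functor_def)

locale adjunction = F: cfunctor A B F + U: cfunctor B A U
  for A :: "('o, 'a, 'm) category_scheme" and B :: "('p, 'b, 'n) category_scheme"
    and F :: "('o, 'a, 'p, 'b) cfunctor" and U :: "('p, 'b, 'o, 'a) cfunctor" +
  fixes \<eta> \<epsilon>
  assumes unit_nat: "nat_trans A A id_functor (comp_functor U F) \<eta>"
    and counit_nat: "nat_trans B B (comp_functor F U) id_functor \<epsilon>"
    and triangle_left: "X \<in> Obj A \<Longrightarrow> \<epsilon> (fob F X) \<cdot>\<^bsub>B\<^esub> farr F (\<eta> X) = ident B (fob F X)"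
    and triangle_right: "Y \<in> Obj B \<Longrightarrow> farr U (\<epsilon> Y) \<cdot>\<^bsub>A\<^esub> \<eta> (fob U Y) = ident A (fob U Y)"
begin

lemma unit_hom [simp]:
  "X \<in> Obj A \<Longrightarrow> \<eta> X \<in> Arr A"
  "X \<in> Obj A \<Longrightarrow> Dom A (\<eta> X) = X"
  "X \<in> Obj A \<Longrightarrow> Cod A (\<eta> X) = fob U (fob F X)"
  using nat_trans_in[OF unit_nat, of X] by (auto simp: hom_def comp_functor_def id_functor_def)

lemma counit_hom [simp]:
  "Y \<in> Obj B \<Longrightarrow> \<epsilon> Y \<in> Arr B"
  "Y \<in> Obj B \<Longrightarrow> Dom B (\<epsilon> Y) = fob F (fob U Y)"
  "Y \<in> Obj B \<Longrightarrow> Cod B (\<epsilon> Y) = Y"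
  using nat_trans_in[OF counit_nat, of Y] by (auto simp: hom_def comp_functor_def id_functor_def)

lemma unit_naturality:
  "f \<in> Arr A \<Longrightarrow> \<eta> (Cod A f) \<cdot>\<^bsub>A\<^esub> f = farr U (farr F f) \<cdot>\<^bsub>A\<^esub> \<eta> (Dom A f)"
  using nat_trans_naturality[OF unit_nat] F.source.category_axioms
  by (simp add: comp_functor_def id_functor_def)

lemma counit_naturality:
  "f \<in> Arr B \<Longrightarrow> \<epsilon> (Cod B f) \<cdot>\<^bsub>B\<^esub> farr F (farr U f) = f \<cdot>\<^bsub>B\<^esub> \<epsilon> (Dom B f)"
  using nat_trans_naturality[OF counit_nat] F.target.category_axioms
  by (simp add: comp_functor_def id_functor_def)

text \<open>
  The next two lemmas are the two halves of the bijection between arrows \<open>F X \<rightarrow> Y\<close> and arrows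
  \<open>X \<rightarrow> U Y\<close>.
\<close>

lemma transpose_unique:
  assumes f: "f \<in> hom A X (fob U Y)" and "Y \<in> Obj B"
  shows "farr U (\<epsilon> Y \<cdot>\<^bsub>B\<^esub> farr F f) \<cdot>\<^bsub>A\<^esub> \<eta> X = f"
proof -
  have [simp]: "f \<in> Arr A" "Dom A f = X" "Cod A f = fob U Y" "X \<in> Obj A" "Y \<in> Obj B"
    using assms by (auto simp: hom_def)
  have "farr U (\<epsilon> Y \<cdot>\<^bsub>B\<^esub> farr F f) \<cdot>\<^bsub>A\<^esub> \<eta> X = farr U (\<epsilon> Y) \<cdot>\<^bsub>A\<^esub> (farr U (farr F f) \<cdot>\<^bsub>A\<^esub> \<eta> X)"
    by (simp add: U.farr_comp F.source.comp_assoc)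
  also have "\<dots> = farr U (\<epsilon> Y) \<cdot>\<^bsub>A\<^esub> (\<eta> (fob U Y) \<cdot>\<^bsub>A\<^esub> f)"
    using unit_naturality[of f] by simp
  also have "\<dots> = (farr U (\<epsilon> Y) \<cdot>\<^bsub>A\<^esub> \<eta> (fob U Y)) \<cdot>\<^bsub>A\<^esub> f"
    by (simp add: F.source.comp_assoc)
  finally show ?thesis
    by (simp add: triangle_right)
qed

lemma transpose_exists:
  assumes q: "q \<in> hom B (fob F X) Y" and X: "X \<in> Obj A"
  shows "\<epsilon> Y \<cdot>\<^bsub>B\<^esub> farr F (farr U q \<cdot>\<^bsub>A\<^esub> \<eta> X) = q"
proof -
  have [simp]: "q \<in> Arr B" "Dom B q = fob F X" "Cod B q = Y" "X \<in> Obj A" "Y \<in> Obj B"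
    using assms by (auto simp: hom_def)
  have "\<epsilon> Y \<cdot>\<^bsub>B\<^esub> farr F (farr U q \<cdot>\<^bsub>A\<^esub> \<eta> X) = (\<epsilon> Y \<cdot>\<^bsub>B\<^esub> farr F (farr U q)) \<cdot>\<^bsub>B\<^esub> farr F (\<eta> X)"
    by (simp add: F.farr_comp F.target.comp_assoc)
  also have "\<epsilon> Y \<cdot>\<^bsub>B\<^esub> farr F (farr U q) = q \<cdot>\<^bsub>B\<^esub> \<epsilon> (fob F X)"
    using counit_naturality[of q] by simp
  finally show ?thesis
    by (simp add: F.target.comp_assoc triangle_left)
qed

abbreviation FU where "FU \<equiv> adjunction_comonad F U \<eta> \<epsilon>"

lemma FU_simps [simp]:
  "fob FU Y = fob F (fob U Y)" "farr FU f = farr F (farr U f)"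
  "comult FU Y = farr F (\<eta> (fob U Y))" "counit FU Y = \<epsilon> Y"
  by (simp_all add: adjunction_comonad_def comp_functor_def)

lemma FU_comonad: "comonad B FU"
proof
  have "\<eta> (fob U (Cod B f)) \<cdot>\<^bsub>A\<^esub> farr U f = farr U (farr F (farr U f)) \<cdot>\<^bsub>A\<^esub> \<eta> (fob U (Dom B f))"
    if "f \<in> Arr B" for f
    using unit_naturality[of "farr U f"] that by simp
  then show "nat_trans B B FU (comp_functor FU FU) (comult FU)"
    by (auto simp: nat_trans_def comp_functor_def hom_def simp flip: F.farr_comp)
  show "nat_trans B B FU id_functor (counit FU)"
    using counit_naturality by (auto simp: nat_trans_def id_functor_def hom_def)
  fix Y assume [simp]: "Y \<in> Obj B"
  show "comult FU (fob FU Y) \<cdot>\<^bsub>B\<^esub> comult FU Y = farr FU (comult FU Y) \<cdot>\<^bsub>B\<^esub> comult FU Y"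
    using unit_naturality[of "\<eta> (fob U Y)"] by (simp flip: F.farr_comp)
  show "counit FU (fob FU Y) \<cdot>\<^bsub>B\<^esub> comult FU Y = ident B (fob FU Y)"
    by (simp add: triangle_left)
  show "farr FU (counit FU Y) \<cdot>\<^bsub>B\<^esub> comult FU Y = ident B (fob FU Y)"
    by (simp add: triangle_right flip: F.farr_comp)
qed (auto simp: hom_def U.farr_comp F.farr_comp)

text \<open>
  The inverse of \<open>F f\<close> is automatically a morphism of coalgebras between the images of the
  comparison functor, hence it comes from an arrow, which is inverse to \<open>f\<close> by faithfulness.
\<close>

lemma reflects_iso_if_comonadic:
  assumes comonadic: "comonadic A B F U \<eta> \<epsilon>" and f: "f \<in> hom A X Y" and "is_iso B (farr F f)"
  shows "is_iso A f"
proof -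
  let ?N = "comparison_functor A F \<eta>" and ?D = "coalgebra_category B FU"
  note N = comonadic[unfolded comonadic_def]
  have [simp]: "f \<in> Arr A" "Dom A f = X" "Cod A f = Y" "X \<in> Obj A" "Y \<in> Obj A"
    using f by (auto simp: hom_def)
  obtain j where j: "j \<in> hom B (fob F Y) (fob F X)" "j \<cdot>\<^bsub>B\<^esub> farr F f = ident B (fob F X)"
      "farr F f \<cdot>\<^bsub>B\<^esub> j = ident B (fob F Y)"
    using F.target.is_isoE[OF assms(3) F.farr_in[OF f]] by blast
  have [simp]: "j \<in> Arr B" "Dom B j = fob F Y" "Cod B j = fob F X"
    using j(1) by (auto simp: hom_def)
  have coalg: "is_coalgebra B FU (fob F Z, farr F (\<eta> Z))" if "Z \<in> Obj A" for Z
    using that unit_naturality[of "\<eta> Z"]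
    by (simp add: is_coalgebra_def hom_def triangle_left flip: F.farr_comp)
  have "farr F (\<eta> X) \<cdot>\<^bsub>B\<^esub> j
      = (farr FU (j \<cdot>\<^bsub>B\<^esub> farr F f) \<cdot>\<^bsub>B\<^esub> farr F (\<eta> X)) \<cdot>\<^bsub>B\<^esub> j"
    by (simp add: j(2))
  also have "\<dots> = farr FU j \<cdot>\<^bsub>B\<^esub> (farr F (farr U (farr F f) \<cdot>\<^bsub>A\<^esub> \<eta> X) \<cdot>\<^bsub>B\<^esub> j)"
    by (simp add: F.farr_comp U.farr_comp F.target.comp_assoc)
  also have "farr U (farr F f) \<cdot>\<^bsub>A\<^esub> \<eta> X = \<eta> Y \<cdot>\<^bsub>A\<^esub> f"
    using unit_naturality[of f] by simp
  also have "farr F (\<eta> Y \<cdot>\<^bsub>A\<^esub> f) \<cdot>\<^bsub>B\<^esub> j = farr F (\<eta> Y) \<cdot>\<^bsub>B\<^esub> (farr F f \<cdot>\<^bsub>B\<^esub> j)"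
    by (simp add: F.farr_comp F.target.comp_assoc)
  finally have j_coalg: "(fob ?N Y, j, fob ?N X) \<in> hom ?D (fob ?N Y) (fob ?N X)"
    by (simp add: in_hom_coalgebra_category comparison_functor_eq_lift lift_functor_def coalg j hom_def)
  then obtain h where h: "h \<in> hom A Y X" "farr F h = j"
    using equivalence_full[OF N _ _ j_coalg] by (auto simp: comparison_functor_eq_lift lift_functor_def)
  have inj: "v = w" if "v \<in> hom A Z Z" "w \<in> hom A Z Z" "farr F v = farr F w" for v w Z
    using equivalence_inj[OF N that(1,2)] that
    by (auto simp: comparison_functor_eq_lift lift_functor_def hom_def)
  show ?thesis
  proof (rule F.source.is_isoI[OF f h(1)])
    show "h \<cdot>\<^bsub>A\<^esub> f = ident A X"
      by (rule inj) (use h j(2) in \<open>auto simp: hom_def F.farr_comp\<close>)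
    show "f \<cdot>\<^bsub>A\<^esub> h = ident A Y"
      by (rule inj) (use h j(3) in \<open>auto simp: hom_def F.farr_comp\<close>)
  qed
qed

end

locale coalgebra_lift = adjunction A B F U \<eta> \<epsilon> + G: comonad B G for A B F U \<eta> \<epsilon> G +
  fixes \<kappa>
  assumes lift_coalgebra: "X \<in> Obj A \<Longrightarrow> is_coalgebra B G (fob F X, \<kappa> X)"
    and lift_nat: "f \<in> Arr A \<Longrightarrow> \<kappa> (Cod A f) \<cdot>\<^bsub>B\<^esub> farr F f = farr G (farr F f) \<cdot>\<^bsub>B\<^esub> \<kappa> (Dom A f)"
begin

abbreviation K where "K \<equiv> lift_functor A F \<kappa>"

text \<open>
  The transpose of the coaction, and the only candidate for a comonad morphism \<open>F U \<rightarrow> G\<close> that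
  turns the coalgebras \<open>F \<eta>\<close> into \<open>\<kappa>\<close>.
\<close>

definition canonical where "canonical Y = farr G (\<epsilon> Y) \<cdot>\<^bsub>B\<^esub> \<kappa> (fob U Y)"

lemma coaction_hom [simp]:
  "X \<in> Obj A \<Longrightarrow> \<kappa> X \<in> Arr B"
  "X \<in> Obj A \<Longrightarrow> Dom B (\<kappa> X) = fob F X"
  "X \<in> Obj A \<Longrightarrow> Cod B (\<kappa> X) = fob G (fob F X)"
  and coaction_comult: "X \<in> Obj A \<Longrightarrow> comult G (fob F X) \<cdot>\<^bsub>B\<^esub> \<kappa> X = farr G (\<kappa> X) \<cdot>\<^bsub>B\<^esub> \<kappa> X"
  and coaction_counit: "X \<in> Obj A \<Longrightarrow> counit G (fob F X) \<cdot>\<^bsub>B\<^esub> \<kappa> X = ident B (fob F X)"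
  using lift_coalgebra[of X] by (auto simp: is_coalgebra_def hom_def)

lemma canonical_hom [simp]:
  "Y \<in> Obj B \<Longrightarrow> canonical Y \<in> Arr B"
  "Y \<in> Obj B \<Longrightarrow> Dom B (canonical Y) = fob F (fob U Y)"
  "Y \<in> Obj B \<Longrightarrow> Cod B (canonical Y) = fob G Y"
  by (auto simp: canonical_def)

lemma canonical_transpose:
  assumes "u \<in> hom A X (fob U Y)" and "Y \<in> Obj B"
  shows "canonical Y \<cdot>\<^bsub>B\<^esub> farr F u = farr G (\<epsilon> Y \<cdot>\<^bsub>B\<^esub> farr F u) \<cdot>\<^bsub>B\<^esub> \<kappa> X"
proof -
  have [simp]: "u \<in> Arr A" "Dom A u = X" "Cod A u = fob U Y" "X \<in> Obj A" "Y \<in> Obj B"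
    using assms by (auto simp: hom_def)
  have "canonical Y \<cdot>\<^bsub>B\<^esub> farr F u = farr G (\<epsilon> Y) \<cdot>\<^bsub>B\<^esub> (\<kappa> (fob U Y) \<cdot>\<^bsub>B\<^esub> farr F u)"
    by (simp add: canonical_def F.target.comp_assoc)
  also have "\<kappa> (fob U Y) \<cdot>\<^bsub>B\<^esub> farr F u = farr G (farr F u) \<cdot>\<^bsub>B\<^esub> \<kappa> X"
    using lift_nat[of u] by simp
  finally show ?thesis
    by (simp add: G.farr_comp F.target.comp_assoc)
qed

text \<open>
  The coaction is recovered from the canonical map, so the pushforward along the latter carries the
  comparison functor to \<open>K\<close>.
\<close>

lemma canonical_unit: "X \<in> Obj A \<Longrightarrow> canonical (fob F X) \<cdot>\<^bsub>B\<^esub> farr F (\<eta> X) = \<kappa> X"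
  using canonical_transpose[of "\<eta> X" X "fob F X"] by (simp add: hom_def triangle_left)

lemma canonical_counit:
  assumes [simp]: "Y \<in> Obj B"
  shows "counit G Y \<cdot>\<^bsub>B\<^esub> canonical Y = \<epsilon> Y"
proof -
  have "counit G Y \<cdot>\<^bsub>B\<^esub> canonical Y = (counit G Y \<cdot>\<^bsub>B\<^esub> farr G (\<epsilon> Y)) \<cdot>\<^bsub>B\<^esub> \<kappa> (fob U Y)"
    by (simp add: canonical_def F.target.comp_assoc)
  also have "counit G Y \<cdot>\<^bsub>B\<^esub> farr G (\<epsilon> Y) = \<epsilon> Y \<cdot>\<^bsub>B\<^esub> counit G (fob F (fob U Y))"
    using G.counit_naturality[of "\<epsilon> Y"] by simp
  finally show ?thesis
    by (simp add: F.target.comp_assoc coaction_counit)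
qed

text \<open>
  The canonical map at \<open>Y\<close> is a coalgebra morphism from \<open>K (U Y)\<close> to the cofree coalgebra on \<open>Y\<close>.
\<close>

lemma canonical_comult:
  assumes [simp]: "Y \<in> Obj B"
  shows "comult G Y \<cdot>\<^bsub>B\<^esub> canonical Y = farr G (canonical Y) \<cdot>\<^bsub>B\<^esub> \<kappa> (fob U Y)"
proof -
  have "comult G Y \<cdot>\<^bsub>B\<^esub> canonical Y = (comult G Y \<cdot>\<^bsub>B\<^esub> farr G (\<epsilon> Y)) \<cdot>\<^bsub>B\<^esub> \<kappa> (fob U Y)"
    by (simp add: canonical_def F.target.comp_assoc)
  also have "comult G Y \<cdot>\<^bsub>B\<^esub> farr G (\<epsilon> Y) = farr G (farr G (\<epsilon> Y)) \<cdot>\<^bsub>B\<^esub> comult G (fob F (fob U Y))"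
    using G.comult_naturality[of "\<epsilon> Y"] by simp
  finally show ?thesis
    by (simp add: canonical_def F.target.comp_assoc coaction_comult G.farr_comp)
qed

lemma canonical_comonad_morphism: "comonad_morphism B FU G canonical"
proof (intro comonad_morphism.intro comonad_morphism_axioms.intro FU_comonad G.comonad_axioms)
  show "nat_trans B B FU G canonical"
    unfolding nat_trans_def
  proof (intro conjI ballI)
    fix X Y f assume "f \<in> hom B X Y"
    then have [simp]: "f \<in> Arr B" "Dom B f = X" "Cod B f = Y" "X \<in> Obj B" "Y \<in> Obj B"
      by (auto simp: hom_def)
    have "canonical Y \<cdot>\<^bsub>B\<^esub> farr FU f
        = farr G (\<epsilon> Y \<cdot>\<^bsub>B\<^esub> farr F (farr U f)) \<cdot>\<^bsub>B\<^esub> \<kappa> (fob U X)"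
      by (simp, rule canonical_transpose) (simp_all add: hom_def)
    also have "\<epsilon> Y \<cdot>\<^bsub>B\<^esub> farr F (farr U f) = f \<cdot>\<^bsub>B\<^esub> \<epsilon> X"
      using counit_naturality[of f] by simp
    finally show "canonical Y \<cdot>\<^bsub>B\<^esub> farr FU f = farr G f \<cdot>\<^bsub>B\<^esub> canonical X"
      by (simp add: canonical_def G.farr_comp F.target.comp_assoc)
  qed (simp add: hom_def)
  fix Y assume Y [simp]: "Y \<in> Obj B"
  show "counit G Y \<cdot>\<^bsub>B\<^esub> canonical Y = counit FU Y"
    by (simp add: canonical_counit)
  show "comult G Y \<cdot>\<^bsub>B\<^esub> canonical Y
      = farr G (canonical Y) \<cdot>\<^bsub>B\<^esub> (canonical (fob FU Y) \<cdot>\<^bsub>B\<^esub> comult FU Y)"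
    by (simp add: canonical_comult canonical_unit)
qed

text \<open>
  Choose an isomorphism \<open>i\<close> from some \<open>K W\<close> to the cofree coalgebra on \<open>Y\<close>, with inverse \<open>j\<close>.
  It factors through the canonical map as \<open>t \<circ> F u\<close>, so \<open>r = F u \<circ> j\<close> is a right inverse of the
  canonical map.  The composite in the other order is an endomorphism of the coalgebra \<open>K (U Y)\<close>,
  and \<open>K\<close> being full forces it to be the identity.
\<close>

lemma canonical_iso_if_equivalence:
  assumes "equivalence_of_categories A (coalgebra_category B G) K" and Y [simp]: "Y \<in> Obj B"
  shows "is_iso B (canonical Y)"
proof -
  have "(fob G Y, comult G Y) \<in> Obj (coalgebra_category B G)"
    by (simp add: G.cofree_coalgebra)
  then obtain W k where W [simp]: "W \<in> Obj A"
    and k: "k \<in> hom (coalgebra_category B G) (fob K W) (fob G Y, comult G Y)"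
    and k_iso: "is_iso (coalgebra_category B G) k"
    using equivalence_eso[OF assms(1)] by blast
  interpret coalg: category "coalgebra_category B G"
    by (rule category_coalgebra_category) (rule G.cfunctor_axioms)
  obtain l where l: "l \<in> hom (coalgebra_category B G) (fob G Y, comult G Y) (fob K W)"
    and lk: "compose (coalgebra_category B G) k l = ident (coalgebra_category B G) (fob G Y, comult G Y)"
    using coalg.is_isoE[OF k_iso k] by blast
  obtain i where i: "k = (fob K W, i, (fob G Y, comult G Y))" "i \<in> hom B (fob F W) (fob G Y)"
      "comult G Y \<cdot>\<^bsub>B\<^esub> i = farr G i \<cdot>\<^bsub>B\<^esub> \<kappa> W"
    using k by (auto simp: in_hom_coalgebra_category lift_functor_def)
  obtain j where j: "l = ((fob G Y, comult G Y), j, fob K W)" "j \<in> hom B (fob G Y) (fob F W)"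
      "\<kappa> W \<cdot>\<^bsub>B\<^esub> j = farr G j \<cdot>\<^bsub>B\<^esub> comult G Y"
    using l by (auto simp: in_hom_coalgebra_category lift_functor_def)
  have ij: "i \<cdot>\<^bsub>B\<^esub> j = ident B (fob G Y)"
    using lk i(1) j(1) by (simp add: lift_functor_def)
  have [simp]: "i \<in> Arr B" "Dom B i = fob F W" "Cod B i = fob G Y"
    "j \<in> Arr B" "Dom B j = fob G Y" "Cod B j = fob F W"
    using i(2) j(2) by (auto simp: hom_def)
  \<comment> \<open>A coalgebra morphism into a cofree coalgebra is determined by its composite \<open>q\<close> with the
    counit, and \<open>q\<close> is the transpose of some \<open>u\<close>; so \<open>i\<close> factors through the canonical arrow.\<close>
  define q where "q = counit G Y \<cdot>\<^bsub>B\<^esub> i"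
  have q: "q \<in> hom B (fob F W) Y"
    by (simp add: q_def hom_def)
  define u where "u = farr U q \<cdot>\<^bsub>A\<^esub> \<eta> W"
  have u: "u \<in> hom A W (fob U Y)"
    using q by (simp add: u_def hom_def)
  then have [simp]: "u \<in> Arr A" "Dom A u = W" "Cod A u = fob U Y"
    by (auto simp: hom_def)
  have "canonical Y \<cdot>\<^bsub>B\<^esub> farr F u = farr G q \<cdot>\<^bsub>B\<^esub> \<kappa> W"
    using canonical_transpose[OF u Y] transpose_exists[OF q W] by (simp add: u_def)
  also have "\<dots> = farr G (counit G Y) \<cdot>\<^bsub>B\<^esub> (comult G Y \<cdot>\<^bsub>B\<^esub> i)"
    by (simp add: q_def i(3) G.farr_comp F.target.comp_assoc)
  also have "\<dots> = (farr G (counit G Y) \<cdot>\<^bsub>B\<^esub> comult G Y) \<cdot>\<^bsub>B\<^esub> i"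
    by (simp add: F.target.comp_assoc)
  finally have factor: "canonical Y \<cdot>\<^bsub>B\<^esub> farr F u = i"
    by (simp add: G.counit_right)
  define r where "r = farr F u \<cdot>\<^bsub>B\<^esub> j"
  have r [simp]: "r \<in> Arr B" "Dom B r = fob G Y" "Cod B r = fob F (fob U Y)"
    by (simp_all add: r_def)
  have tr: "canonical Y \<cdot>\<^bsub>B\<^esub> r = ident B (fob G Y)"
    using factor ij by (simp add: r_def flip: F.target.comp_assoc)
  have r_coalg: "\<kappa> (fob U Y) \<cdot>\<^bsub>B\<^esub> r = farr G r \<cdot>\<^bsub>B\<^esub> comult G Y"
  proof -
    have "\<kappa> (fob U Y) \<cdot>\<^bsub>B\<^esub> r = (\<kappa> (fob U Y) \<cdot>\<^bsub>B\<^esub> farr F u) \<cdot>\<^bsub>B\<^esub> j"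
      by (simp add: r_def F.target.comp_assoc)
    also have "\<kappa> (fob U Y) \<cdot>\<^bsub>B\<^esub> farr F u = farr G (farr F u) \<cdot>\<^bsub>B\<^esub> \<kappa> W"
      using lift_nat[of u] by simp
    finally show ?thesis
      using j(3) by (simp add: r_def G.farr_comp F.target.comp_assoc)
  qed
  \<comment> \<open>By fullness \<open>r\<close> after the canonical arrow is \<open>F w\<close>, and the counit identifies \<open>w\<close>.\<close>
  let ?e = "r \<cdot>\<^bsub>B\<^esub> canonical Y"
  have "\<kappa> (fob U Y) \<cdot>\<^bsub>B\<^esub> ?e = (\<kappa> (fob U Y) \<cdot>\<^bsub>B\<^esub> r) \<cdot>\<^bsub>B\<^esub> canonical Y"
    by (simp add: F.target.comp_assoc)
  also have "\<dots> = farr G r \<cdot>\<^bsub>B\<^esub> (comult G Y \<cdot>\<^bsub>B\<^esub> canonical Y)"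
    by (simp add: r_coalg F.target.comp_assoc)
  also have "\<dots> = farr G ?e \<cdot>\<^bsub>B\<^esub> \<kappa> (fob U Y)"
    by (simp add: canonical_comult G.farr_comp F.target.comp_assoc)
  finally have e_coalg: "(fob K (fob U Y), ?e, fob K (fob U Y))
      \<in> hom (coalgebra_category B G) (fob K (fob U Y)) (fob K (fob U Y))"
    by (simp add: in_hom_coalgebra_category lift_functor_def lift_coalgebra hom_def)
  then obtain w where w: "w \<in> hom A (fob U Y) (fob U Y)" and Fw: "farr F w = ?e"
    using equivalence_full[OF assms(1) _ _ e_coalg] by (auto simp: lift_functor_def)
  have "canonical Y \<cdot>\<^bsub>B\<^esub> ?e = canonical Y"
    using tr by (simp flip: F.target.comp_assoc)
  then have "\<epsilon> Y \<cdot>\<^bsub>B\<^esub> farr F w = counit G Y \<cdot>\<^bsub>B\<^esub> canonical Y"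
    by (simp add: Fw F.target.comp_assoc flip: canonical_counit)
  then have "w = farr U (\<epsilon> Y) \<cdot>\<^bsub>A\<^esub> \<eta> (fob U Y)"
    using transpose_unique[OF w Y] by (simp add: canonical_counit)
  then have "w = ident A (fob U Y)"
    by (simp add: triangle_right)
  then have "?e = ident B (fob F (fob U Y))"
    using Fw by simp
  then show ?thesis
    using tr by (intro F.target.is_isoI[of _ "fob F (fob U Y)" "fob G Y" r]) (simp_all add: hom_def)
qed

text \<open>
  When the canonical map is invertible, pushing forward along it and along its inverse is an
  isomorphism between the coalgebras of \<open>F U\<close> and those of \<open>G\<close>, which takes the comparison functor
  to \<open>K\<close>.  Comonadicity is equivalence of the comparison functor.
\<close>

theorem equivalence_iff_comonadic_and_canonical_iso:
  "equivalence_of_categories A (coalgebra_category B G) K \<longleftrightarrow>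
    comonadic A B F U \<eta> \<epsilon> \<and> (\<forall>Y \<in> Obj B. is_iso B (canonical Y))"
proof -
  let ?N = "comparison_functor A F \<eta>"
  have "equivalence_of_categories A (coalgebra_category B G) K
      \<longleftrightarrow> equivalence_of_categories A (coalgebra_category B FU) ?N"
    if iso: "\<forall>Y \<in> Obj B. is_iso B (canonical Y)"
  proof -
    interpret t: comonad_morphism B FU G canonical
      by (rule canonical_comonad_morphism)
    have "\<forall>Y \<in> Obj B. \<exists>s. s \<in> hom B (fob G Y) (fob FU Y) \<and>
        s \<cdot>\<^bsub>B\<^esub> canonical Y = ident B (fob FU Y) \<and> canonical Y \<cdot>\<^bsub>B\<^esub> s = ident B (fob G Y)"
      using iso by (auto simp: is_iso_def)
    then obtain s where s: "\<And>Y. Y \<in> Obj B \<Longrightarrow> s Y \<in> hom B (fob G Y) (fob FU Y)"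
        "\<And>Y. Y \<in> Obj B \<Longrightarrow> s Y \<cdot>\<^bsub>B\<^esub> canonical Y = ident B (fob FU Y)"
        "\<And>Y. Y \<in> Obj B \<Longrightarrow> canonical Y \<cdot>\<^bsub>B\<^esub> s Y = ident B (fob G Y)"
      by metis
    interpret s: comonad_morphism B G FU s
      by (rule t.inverse_comonad_morphism) (fact s)+
    have st: "fob s.pushforward (fob t.pushforward X) = X" if "X \<in> Obj (coalgebra_category B FU)" for X
      using pushforward_inverse(1)[OF t.comonad_morphism_axioms s.comonad_morphism_axioms] s(2) that
      by blast
    have ts: "fob t.pushforward (fob s.pushforward X) = X" if "X \<in> Obj (coalgebra_category B G)" for X
      using pushforward_inverse(1)[OF s.comonad_morphism_axioms t.comonad_morphism_axioms] s(3) that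
      by blast
    have st_arr: "farr s.pushforward (farr t.pushforward f) = f"
      if "f \<in> Arr (coalgebra_category B FU)" for f
      using pushforward_inverse(2)[OF t.comonad_morphism_axioms s.comonad_morphism_axioms] s(2) that
      by blast
    have ts_arr: "farr t.pushforward (farr s.pushforward f) = f"
      if "f \<in> Arr (coalgebra_category B G)" for f
      using pushforward_inverse(2)[OF s.comonad_morphism_axioms t.comonad_morphism_axioms] s(3) that
      by blast
    have K_ob: "fob K X = fob t.pushforward (fob ?N X)" if "X \<in> Obj A" for X
      using that
      by (simp add: lift_functor_def comparison_functor_eq_lift t.pushforward_def t.push_ob_def
          canonical_unit)
    have K_arr: "farr K f = farr t.pushforward (farr ?N f)" if "f \<in> Arr A" for f
      using that
      by (simp add: lift_functor_def comparison_functor_eq_lift t.pushforward_def t.push_ob_def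
          canonical_unit)
    show ?thesis
    proof
      assume N: "equivalence_of_categories A (coalgebra_category B FU) ?N"
      show "equivalence_of_categories A (coalgebra_category B G) K"
        by (rule equivalence_transport[OF N t.pushforward_cfunctor s.pushforward_cfunctor])
          (use st ts st_arr ts_arr K_ob K_arr in \<open>blast\<close>)+
    next
      assume K: "equivalence_of_categories A (coalgebra_category B G) K"
      have N_ob: "fob ?N X = fob s.pushforward (fob K X)" if X: "X \<in> Obj A" for X
      proof -
        have "is_coalgebra B FU (fob ?N X)"
          using that unit_naturality[of "\<eta> X"]
          by (simp add: comparison_functor_eq_lift lift_functor_def is_coalgebra_def hom_def
              triangle_left flip: F.farr_comp)
        then show ?thesis
          using st[of "fob ?N X"] K_ob[OF X] by simp
      qed
      have N_arr: "farr ?N f = farr s.pushforward (farr K f)" if "f \<in> Arr A" for f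
        using that N_ob[of "Dom A f"] N_ob[of "Cod A f"]
        by (simp add: lift_functor_def comparison_functor_eq_lift s.pushforward_def)
      show "equivalence_of_categories A (coalgebra_category B FU) ?N"
        by (rule equivalence_transport[OF K s.pushforward_cfunctor t.pushforward_cfunctor])
          (use st ts st_arr ts_arr N_ob N_arr in \<open>blast\<close>)+
    qed
  qed
  then show ?thesis
    using canonical_iso_if_equivalence unfolding comonadic_def by blast
qed

end


section \<open>Comonoids and their comonads\<close>

context strict_monoidal_category
begin

lemmas tensor_ob_simps [simp] =
  tensor_in unit_in tensor_assoc tensor_unit_left tensor_unit_right
  tensor_arr_assoc tensor_arr_unit_left tensor_arr_unit_right tensor_ident

lemma tensor_Arr [simp]:
  "\<lbrakk>f \<in> Arr V; g \<in> Arr V\<rbrakk> \<Longrightarrow> f \<boxtimes> g \<in> Arr V"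
  "\<lbrakk>f \<in> Arr V; g \<in> Arr V\<rbrakk> \<Longrightarrow> Dom V (f \<boxtimes> g) = Dom V f \<otimes> Dom V g"
  "\<lbrakk>f \<in> Arr V; g \<in> Arr V\<rbrakk> \<Longrightarrow> Cod V (f \<boxtimes> g) = Cod V f \<otimes> Cod V g"
  using tensor_arr_in[of f "Dom V f" "Cod V f" g "Dom V g" "Cod V g"] by (auto simp: hom_def)

lemma interchange:
  "\<lbrakk>f \<in> Arr V; f' \<in> Arr V; g \<in> Arr V; g' \<in> Arr V; Dom V f' = Cod V f; Dom V g' = Cod V g\<rbrakk> \<Longrightarrow>
    (f' \<boxtimes> g') \<cdot> (f \<boxtimes> g) = (f' \<cdot> f) \<boxtimes> (g' \<cdot> g)"
  using tensor_compose[of f "Dom V f" "Cod V f" f' "Cod V f'" g "Dom V g" "Cod V g" g' "Cod V g'"]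
  by (auto simp: hom_def)

end

text \<open>
  A comodule over \<open>C\<close> and a coalgebra for \<open>- \<otimes> C\<close> are the same data under the same equations.
\<close>

lemma comodule_category_eq_coalgebra_category:
  "comodule_category V C = coalgebra_category V (comonoid_comonad V C)"
proof -
  have "is_right_comodule V C = is_coalgebra V (comonoid_comonad V C)"
    by (auto simp: fun_eq_iff is_right_comodule_def is_coalgebra_def comonoid_comonad_def)
  then show ?thesis
    by (simp add: comodule_category_def coalgebra_category_def comonoid_comonad_def)
qed

context comonoid
begin

lemma comonoid_hom [simp]:
  "car C \<in> Obj V"
  "delta C \<in> Arr V" "Dom V (delta C) = car C" "Cod V (delta C) = car C \<otimes> car C"
  "eps C \<in> Arr V" "Dom V (eps C) = car C" "Cod V (eps C) = \<I>"
  using car_in delta_in eps_in by (auto simp: hom_def)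

end

lemma comonoid_comonad:
  fixes V (structure) and C :: "('o, 'a) comonoid"
  assumes "comonoid V C"
  shows "comonad V (comonoid_comonad V C)"
proof -
  interpret comonoid V C by fact
  show ?thesis
  proof
    let ?G = "comonoid_comonad V C"
    show "nat_trans V V ?G (comp_functor ?G ?G) (comult ?G)"
      by (auto simp: nat_trans_def comp_functor_def comonoid_comonad_def hom_def interchange)
    have "f \<cdot> (ident V (Dom V f) \<boxtimes> eps C) = f \<boxtimes> eps C" if "f \<in> Arr V" for f
    proof -
      have "(f \<boxtimes> ident V \<I>) \<cdot> (ident V (Dom V f) \<boxtimes> eps C) = f \<boxtimes> eps C"
        using that by (subst interchange) simp_all
      then show ?thesis using that by simp
    qed
    then show "nat_trans V V ?G id_functor (counit ?G)"
      by (auto simp: nat_trans_def id_functor_def comonoid_comonad_def hom_def interchange)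
    fix A assume [simp]: "A \<in> Obj V"
    have "(ident V (A \<otimes> car C) \<boxtimes> delta C) \<cdot> (ident V A \<boxtimes> delta C)
        = (ident V A \<boxtimes> (ident V (car C) \<boxtimes> delta C)) \<cdot> (ident V A \<boxtimes> delta C)"
      by (simp flip: tensor_ident)
    then show "comult ?G (fob ?G A) \<cdot> comult ?G A = farr ?G (comult ?G A) \<cdot> comult ?G A"
      by (simp add: comonoid_comonad_def interchange coassoc del: tensor_ident)
    have "(ident V (A \<otimes> car C) \<boxtimes> eps C) \<cdot> (ident V A \<boxtimes> delta C)
        = (ident V A \<boxtimes> (ident V (car C) \<boxtimes> eps C)) \<cdot> (ident V A \<boxtimes> delta C)"
      by (simp flip: tensor_ident)
    then show "counit ?G (fob ?G A) \<cdot> comult ?G A = ident V (fob ?G A)"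
      by (simp add: comonoid_comonad_def interchange counit_right)
    show "farr ?G (counit ?G A) \<cdot> comult ?G A = ident V (fob ?G A)"
      by (simp add: comonoid_comonad_def interchange counit_left)
  qed (auto simp: comonoid_comonad_def hom_def interchange)
qed


section \<open>The Eilenberg--Moore category of an opmonoidal monad\<close>

lemma EM_simps [simp]:
  "Obj (EM_monoidal V T) = {X. is_algebra V T X}"
  "Dom (EM_monoidal V T) (X, f, Y) = X"
  "Cod (EM_monoidal V T) (X, f, Y) = Y"
  "ident (EM_monoidal V T) X = (X, ident V (fst X), X)"
  "compose (EM_monoidal V T) (Y', g, Z) (X, f, Y) = (X, g \<cdot>\<^bsub>V\<^esub> f, Z)"
  "(X, f, Y) \<in> Arr (EM_monoidal V T) \<longleftrightarrow>
    is_algebra V T X \<and> is_algebra V T Y \<and> f \<in> hom V (fst X) (fst Y) \<and>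
    f \<cdot>\<^bsub>V\<^esub> snd X = snd Y \<cdot>\<^bsub>V\<^esub> farr T f"
  "tensor (EM_monoidal V T) = EM_tensor V T"
  "tensor_arr (EM_monoidal V T) (X, f, X') (Y, g, Y')
    = (EM_tensor V T X Y, f \<boxtimes>\<^bsub>V\<^esub> g, EM_tensor V T X' Y')"
  "unit_ob (EM_monoidal V T) = (\<I>\<^bsub>V\<^esub>, theta T)"
  by (auto simp: EM_monoidal_def EM_category_def category.defs monoidal_category.defs
      split: prod.splits)

lemma in_hom_EM:
  "k \<in> hom (EM_monoidal V T) X Y \<longleftrightarrow>
    (\<exists>f. k = (X, f, Y) \<and> is_algebra V T X \<and> is_algebra V T Y \<and> f \<in> hom V (fst X) (fst Y) \<and>
      f \<cdot>\<^bsub>V\<^esub> snd X = snd Y \<cdot>\<^bsub>V\<^esub> farr T f)"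
  by (cases k) (auto simp: hom_def)

text \<open>
  Coalgebras only see the category underlying the monoidal category, so comonadicity of the free
  functor may be discussed in either.
\<close>

lemma coalgebra_category_EM_monoidal:
  "coalgebra_category (EM_monoidal V T) G = coalgebra_category (EM_category V T) G"
  by (simp add: coalgebra_category_def structured_category_def is_coalgebra_def hom_def fun_eq_iff
      EM_monoidal_def category.defs monoidal_category.defs)

lemma EM_tensor_simp [simp]:
  "EM_tensor V T (A, h) (B, k) = (A \<otimes>\<^bsub>V\<^esub> B, (h \<boxtimes>\<^bsub>V\<^esub> k) \<cdot>\<^bsub>V\<^esub> chi T A B)"
  by (simp add: EM_tensor_def)

context monad
begin

lemma mult_hom [simp]:
  "A \<in> Obj C \<Longrightarrow> mult T A \<in> Arr C"
  "A \<in> Obj C \<Longrightarrow> Dom C (mult T A) = fob T (fob T A)"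
  "A \<in> Obj C \<Longrightarrow> Cod C (mult T A) = fob T A"
  using nat_trans_in[OF mult_nat, of A] by (auto simp: hom_def comp_functor_def)

lemma munit_hom [simp]:
  "A \<in> Obj C \<Longrightarrow> munit T A \<in> Arr C"
  "A \<in> Obj C \<Longrightarrow> Dom C (munit T A) = A"
  "A \<in> Obj C \<Longrightarrow> Cod C (munit T A) = fob T A"
  using nat_trans_in[OF munit_nat, of A] by (auto simp: hom_def id_functor_def)

lemma mult_naturality:
  "f \<in> Arr C \<Longrightarrow> mult T (Cod C f) \<cdot> farr T (farr T f) = farr T f \<cdot> mult T (Dom C f)"
  using nat_trans_naturality[OF mult_nat] source.category_axioms by (simp add: comp_functor_def)

lemma munit_naturality:
  "f \<in> Arr C \<Longrightarrow> munit T (Cod C f) \<cdot> f = farr T f \<cdot> munit T (Dom C f)"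
  using nat_trans_naturality[OF munit_nat] source.category_axioms by (simp add: id_functor_def)

lemma algebraD:
  assumes "is_algebra C T (A, h)"
  shows "A \<in> Obj C" "h \<in> Arr C" "Dom C h = fob T A" "Cod C h = A"
    and "h \<cdot> mult T A = h \<cdot> farr T h" "h \<cdot> munit T A = ident C A"
  using assms by (auto simp: is_algebra_def hom_def)

lemma free_algebra: "A \<in> Obj C \<Longrightarrow> is_algebra C T (fob T A, mult T A)"
  by (simp add: is_algebra_def hom_def mult_assoc munit_left)

end

context opmonoidal_monad
begin

abbreviation W where "W \<equiv> EM_monoidal V T"
abbreviation \<phi> where "\<phi> \<equiv> free_functor V T"

lemma chi_hom [simp]:
  "\<lbrakk>A \<in> Obj V; B \<in> Obj V\<rbrakk> \<Longrightarrow> chi T A B \<in> Arr V"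
  "\<lbrakk>A \<in> Obj V; B \<in> Obj V\<rbrakk> \<Longrightarrow> Dom V (chi T A B) = fob T (A \<otimes> B)"
  "\<lbrakk>A \<in> Obj V; B \<in> Obj V\<rbrakk> \<Longrightarrow> Cod V (chi T A B) = fob T A \<otimes> fob T B"
  using chi_in[of A B] by (auto simp: hom_def)

lemma theta_hom [simp]: "theta T \<in> Arr V" "Dom V (theta T) = fob T \<I>" "Cod V (theta T) = \<I>"
  using theta_in by (auto simp: hom_def)

lemma chi_naturality:
  "\<lbrakk>f \<in> Arr V; g \<in> Arr V\<rbrakk> \<Longrightarrow>
    chi T (Cod V f) (Cod V g) \<cdot> farr T (f \<boxtimes> g) = (farr T f \<boxtimes> farr T g) \<cdot> chi T (Dom V f) (Dom V g)"
  by (rule chi_nat) (auto simp: hom_def)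

lemma EM_tensor_algebra:
  assumes X: "is_algebra V T X" and Y: "is_algebra V T Y"
  shows "is_algebra V T (EM_tensor V T X Y)"
proof -
  obtain A h B k where XY: "X = (A, h)" "Y = (B, k)" by (cases X; cases Y)
  note [simp] = algebraD[OF X[unfolded XY]] algebraD[OF Y[unfolded XY]]
  let ?H = "(h \<boxtimes> k) \<cdot> chi T A B"
  have "?H \<cdot> mult T (A \<otimes> B) = (h \<boxtimes> k) \<cdot> (chi T A B \<cdot> mult T (A \<otimes> B))"
    by (simp add: comp_assoc)
  also have "\<dots> = ((h \<boxtimes> k) \<cdot> (mult T A \<boxtimes> mult T B)) \<cdot> (chi T (fob T A) (fob T B) \<cdot> farr T (chi T A B))"
    by (simp add: chi_mult comp_assoc)
  also have "(h \<boxtimes> k) \<cdot> (mult T A \<boxtimes> mult T B) = (h \<boxtimes> k) \<cdot> (farr T h \<boxtimes> farr T k)"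
    by (simp add: interchange)
  also have "\<dots> \<cdot> (chi T (fob T A) (fob T B) \<cdot> farr T (chi T A B))
      = (h \<boxtimes> k) \<cdot> (((farr T h \<boxtimes> farr T k) \<cdot> chi T (fob T A) (fob T B)) \<cdot> farr T (chi T A B))"
    by (simp add: comp_assoc)
  also have "(farr T h \<boxtimes> farr T k) \<cdot> chi T (fob T A) (fob T B) = chi T A B \<cdot> farr T (h \<boxtimes> k)"
    using chi_naturality[of h k] by simp
  also have "(h \<boxtimes> k) \<cdot> ((chi T A B \<cdot> farr T (h \<boxtimes> k)) \<cdot> farr T (chi T A B)) = ?H \<cdot> farr T ?H"
    by (simp add: comp_assoc farr_comp)
  finally have "?H \<cdot> mult T (A \<otimes> B) = ?H \<cdot> farr T ?H" .
  moreover have "?H \<cdot> munit T (A \<otimes> B) = ident V (A \<otimes> B)"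
    by (simp add: comp_assoc chi_munit interchange)
  ultimately show ?thesis
    by (simp add: XY is_algebra_def hom_def)
qed

lemma unit_algebra: "is_algebra V T (\<I>, theta T)"
  by (simp add: is_algebra_def hom_def theta_mult theta_munit)

lemma EM_tensor_arr:
  assumes "is_algebra V T (A, h)" "is_algebra V T (A', h')" "f \<in> hom V A A'" "f \<cdot> h = h' \<cdot> farr T f"
    and "is_algebra V T (B, k)" "is_algebra V T (B', k')" "g \<in> hom V B B'" "g \<cdot> k = k' \<cdot> farr T g"
  shows "(f \<boxtimes> g) \<cdot> ((h \<boxtimes> k) \<cdot> chi T A B) = ((h' \<boxtimes> k') \<cdot> chi T A' B') \<cdot> farr T (f \<boxtimes> g)"
proof -
  note [simp] = algebraD(1-4)[OF assms(1)] algebraD(1-4)[OF assms(2)]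
    algebraD(1-4)[OF assms(5)] algebraD(1-4)[OF assms(6)]
  have [simp]: "f \<in> Arr V" "Dom V f = A" "Cod V f = A'" "g \<in> Arr V" "Dom V g = B" "Cod V g = B'"
    using assms by (auto simp: hom_def)
  have "(f \<boxtimes> g) \<cdot> ((h \<boxtimes> k) \<cdot> chi T A B) = ((f \<boxtimes> g) \<cdot> (h \<boxtimes> k)) \<cdot> chi T A B"
    by (simp add: comp_assoc)
  also have "(f \<boxtimes> g) \<cdot> (h \<boxtimes> k) = (h' \<boxtimes> k') \<cdot> (farr T f \<boxtimes> farr T g)"
    by (simp add: interchange assms(4,8))
  also have "\<dots> \<cdot> chi T A B = (h' \<boxtimes> k') \<cdot> ((farr T f \<boxtimes> farr T g) \<cdot> chi T A B)"
    by (simp add: comp_assoc)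
  also have "(farr T f \<boxtimes> farr T g) \<cdot> chi T A B = chi T A' B' \<cdot> farr T (f \<boxtimes> g)"
    using chi_naturality[of f g] by simp
  finally show ?thesis by (simp add: comp_assoc)
qed

lemma EM_tensor_assoc:
  assumes "is_algebra V T X" "is_algebra V T Y" "is_algebra V T Z"
  shows "EM_tensor V T (EM_tensor V T X Y) Z = EM_tensor V T X (EM_tensor V T Y Z)"
proof -
  obtain A h B k D l where XYZ: "X = (A, h)" "Y = (B, k)" "Z = (D, l)" by (cases X; cases Y; cases Z)
  note [simp] = algebraD[OF assms(1)[unfolded XYZ]] algebraD[OF assms(2)[unfolded XYZ]]
    algebraD[OF assms(3)[unfolded XYZ]]
  have "(((h \<boxtimes> k) \<cdot> chi T A B) \<boxtimes> l) \<cdot> chi T (A \<otimes> B) D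
      = (((h \<boxtimes> k) \<boxtimes> l) \<cdot> (chi T A B \<boxtimes> ident V (fob T D))) \<cdot> chi T (A \<otimes> B) D"
    by (subst interchange) (simp_all del: tensor_arr_assoc)
  also have "\<dots> = (h \<boxtimes> (k \<boxtimes> l)) \<cdot> ((chi T A B \<boxtimes> ident V (fob T D)) \<cdot> chi T (A \<otimes> B) D)"
    by (simp add: comp_assoc)
  also have "\<dots> = ((h \<boxtimes> (k \<boxtimes> l)) \<cdot> (ident V (fob T A) \<boxtimes> chi T B D)) \<cdot> chi T A (B \<otimes> D)"
    by (simp add: chi_coassoc comp_assoc)
  also have "\<dots> = (h \<boxtimes> ((k \<boxtimes> l) \<cdot> chi T B D)) \<cdot> chi T A (B \<otimes> D)"
    by (subst interchange) simp_all
  finally show ?thesis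
    by (simp add: XYZ)
qed

lemma EM_tensor_unit:
  assumes "is_algebra V T X"
  shows "EM_tensor V T (\<I>, theta T) X = X" "EM_tensor V T X (\<I>, theta T) = X"
proof -
  obtain A h where X: "X = (A, h)" by (cases X)
  note [simp] = algebraD[OF assms[unfolded X]]
  have "(theta T \<boxtimes> h) \<cdot> chi T \<I> A = ((ident V \<I> \<boxtimes> h) \<cdot> (theta T \<boxtimes> ident V (fob T A))) \<cdot> chi T \<I> A"
    by (subst interchange) simp_all
  also have "\<dots> = h"
    by (simp add: comp_assoc chi_counit_left)
  finally show "EM_tensor V T (\<I>, theta T) X = X"
    by (simp add: X)
  have "(h \<boxtimes> theta T) \<cdot> chi T A \<I> = ((h \<boxtimes> ident V \<I>) \<cdot> (ident V (fob T A) \<boxtimes> theta T)) \<cdot> chi T A \<I>"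
    by (subst interchange) simp_all
  also have "\<dots> = h"
    by (simp add: comp_assoc chi_counit_right)
  finally show "EM_tensor V T X (\<I>, theta T) = X"
    by (simp add: X)
qed

lemma category_EM: "category W"
proof -
  have "category (EM_category V T)"
    unfolding EM_category_def
  proof (rule category_structured_category)
    show "category V" ..
    fix X Y Z f g
    assume X: "is_algebra V T X" and Y: "is_algebra V T Y" and Z: "is_algebra V T Z"
      and fg: "f \<in> hom V (fst X) (fst Y)" "g \<in> hom V (fst Y) (fst Z)"
      and Q: "(case X of (A, h) \<Rightarrow> \<lambda>f (B, k). f \<cdot> h = k \<cdot> farr T f) f Y"
        "(case Y of (A, h) \<Rightarrow> \<lambda>f (B, k). f \<cdot> h = k \<cdot> farr T f) g Z"
    obtain A h B k D l where XYZ: "X = (A, h)" "Y = (B, k)" "Z = (D, l)"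
      by (cases X; cases Y; cases Z)
    note [simp] = algebraD(1-4)[OF X[unfolded XYZ]] algebraD(1-4)[OF Y[unfolded XYZ]]
      algebraD(1-4)[OF Z[unfolded XYZ]]
    have [simp]: "f \<in> Arr V" "Dom V f = A" "Cod V f = B" "g \<in> Arr V" "Dom V g = B" "Cod V g = D"
      using fg by (auto simp: XYZ hom_def)
    have Q: "f \<cdot> h = k \<cdot> farr T f" "g \<cdot> k = l \<cdot> farr T g"
      using Q by (simp_all add: XYZ)
    have "(g \<cdot> f) \<cdot> h = (g \<cdot> k) \<cdot> farr T f"
      by (simp add: Q(1) comp_assoc)
    also have "\<dots> = l \<cdot> farr T (g \<cdot> f)"
      by (simp add: Q(2) comp_assoc farr_comp)
    finally show "(case X of (A, h) \<Rightarrow> \<lambda>f (B, k). f \<cdot> h = k \<cdot> farr T f) (g \<cdot> f) Z"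
      by (simp add: XYZ)
  qed (auto simp: is_algebra_def hom_def)
  then show ?thesis
    by (simp add: category_def hom_def EM_monoidal_def category.defs monoidal_category.defs)
qed

lemma strict_monoidal_EM: "strict_monoidal_category W"
proof (intro strict_monoidal_category.intro category_EM strict_monoidal_category_axioms.intro)
  fix f X X' g Y Y' assume f: "f \<in> hom W X X'" and g: "g \<in> hom W Y Y'"
  obtain A h A' h' B k B' k' where XY: "X = (A, h)" "X' = (A', h')" "Y = (B, k)" "Y' = (B', k')"
    by (cases X; cases X'; cases Y; cases Y')
  obtain f0 where f0: "f = (X, f0, X')" "is_algebra V T X" "is_algebra V T X'" "f0 \<in> hom V A A'"
      "f0 \<cdot> h = h' \<cdot> farr T f0"
    using f by (auto simp: in_hom_EM XY)
  obtain g0 where g0: "g = (Y, g0, Y')" "is_algebra V T Y" "is_algebra V T Y'" "g0 \<in> hom V B B'"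
      "g0 \<cdot> k = k' \<cdot> farr T g0"
    using g by (auto simp: in_hom_EM XY)
  show "f \<boxtimes>\<^bsub>W\<^esub> g \<in> hom W (X \<otimes>\<^bsub>W\<^esub> Y) (X' \<otimes>\<^bsub>W\<^esub> Y')"
    using f0 g0 EM_tensor_arr[of A h A' h' f0 B k B' k' g0] EM_tensor_algebra[of X Y]
      EM_tensor_algebra[of X' Y'] tensor_arr_in[OF f0(4) g0(4)]
    by (simp add: in_hom_EM XY)
next
  fix f A A' f' A'' g B B' g' B''
  assume "f \<in> hom W A A'" "f' \<in> hom W A' A''" "g \<in> hom W B B'" "g' \<in> hom W B' B''"
  then show "(f' \<cdot>\<^bsub>W\<^esub> f) \<boxtimes>\<^bsub>W\<^esub> (g' \<cdot>\<^bsub>W\<^esub> g) = (f' \<boxtimes>\<^bsub>W\<^esub> g') \<cdot>\<^bsub>W\<^esub> (f \<boxtimes>\<^bsub>W\<^esub> g)"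
    by (auto simp: in_hom_EM tensor_compose)
next
  fix f g h assume "f \<in> Arr W" "g \<in> Arr W" "h \<in> Arr W"
  then show "(f \<boxtimes>\<^bsub>W\<^esub> g) \<boxtimes>\<^bsub>W\<^esub> h = f \<boxtimes>\<^bsub>W\<^esub> (g \<boxtimes>\<^bsub>W\<^esub> h)"
    by (cases f; cases g; cases h) (auto simp: EM_tensor_assoc hom_def simp del: EM_tensor_simp)
next
  fix f assume f: "f \<in> Arr W"
  obtain X f0 Y where XY: "f = (X, f0, Y)" by (cases f)
  have "is_algebra V T X" "is_algebra V T Y" "f0 \<in> Arr V"
    using f unfolding XY EM_simps by (simp_all only: hom_def mem_Collect_eq)
  then show "ident W \<I>\<^bsub>W\<^esub> \<boxtimes>\<^bsub>W\<^esub> f = f" "f \<boxtimes>\<^bsub>W\<^esub> ident W \<I>\<^bsub>W\<^esub> = f"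
    by (simp_all add: XY EM_tensor_unit)
next
  fix X Y assume "X \<in> Obj W" "Y \<in> Obj W"
  then show "X \<otimes>\<^bsub>W\<^esub> Y \<in> Obj W" "ident W X \<boxtimes>\<^bsub>W\<^esub> ident W Y = ident W (X \<otimes>\<^bsub>W\<^esub> Y)"
    by (cases X; cases Y; simp add: EM_tensor_algebra del: EM_tensor_simp;
        simp add: algebraD(1))+
next
  fix X Y Z assume "X \<in> Obj W" "Y \<in> Obj W" "Z \<in> Obj W"
  then show "(X \<otimes>\<^bsub>W\<^esub> Y) \<otimes>\<^bsub>W\<^esub> Z = X \<otimes>\<^bsub>W\<^esub> (Y \<otimes>\<^bsub>W\<^esub> Z)"
    by (simp add: EM_tensor_assoc)
qed (simp_all add: EM_tensor_unit unit_algebra)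

end

context opmonoidal_monad
begin

lemma free_functor_simps [simp]:
  "fob \<phi> A = (fob T A, mult T A)"
  "farr \<phi> f = ((fob T (Dom V f), mult T (Dom V f)), farr T f, (fob T (Cod V f), mult T (Cod V f)))"
  by (simp_all add: free_functor_def)

lemma free_adjunction: "adjunction V W \<phi> forgetful_functor (munit T) (EM_counit V T)"
proof -
  interpret W: strict_monoidal_category W by (rule strict_monoidal_EM)
  have F: "cfunctor V W \<phi>"
    by unfold_locales
      (auto simp: hom_def in_hom_EM free_algebra mult_naturality farr_comp)
  have U: "cfunctor W V forgetful_functor"
    by unfold_locales
      (auto simp: in_hom_EM forgetful_functor_def is_algebra_def)
  show ?thesis
  proof (intro adjunction.intro adjunction_axioms.intro F U)
    show "nat_trans V V id_functor (comp_functor forgetful_functor \<phi>) (munit T)"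
      using munit_naturality
      by (auto simp: nat_trans_def id_functor_def comp_functor_def forgetful_functor_def hom_def)
    show "nat_trans W W (comp_functor \<phi> forgetful_functor) id_functor (EM_counit V T)"
      by (auto simp: nat_trans_def id_functor_def comp_functor_def forgetful_functor_def in_hom_EM
          EM_counit_def free_algebra hom_def dest: algebraD)
    show "EM_counit V T (fob \<phi> A) \<cdot>\<^bsub>W\<^esub> farr \<phi> (munit T A) = ident W (fob \<phi> A)" if "A \<in> Obj V" for A
      using that by (simp add: EM_counit_def munit_right)
    show "farr forgetful_functor (EM_counit V T X) \<cdot> munit T (fob forgetful_functor X)
        = ident V (fob forgetful_functor X)" if "X \<in> Obj W" for X
      using that by (cases X) (simp add: EM_counit_def forgetful_functor_def algebraD(6))
  qed
qed

text \<open>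
  Compatibility of \<open>\<chi>\<close> with the multiplication says that \<open>\<chi>\<close> is a map of algebras from \<open>\<phi> (A \<otimes> B)\<close>
  to \<open>\<phi> A \<otimes> \<phi> B\<close>.  The comultiplication of the free comonoid and the coaction of \<open>K\<close> are algebra
  maps because they are composites of \<open>\<chi>\<close> with free maps.
\<close>

lemma chi_algebra_map:
  assumes [simp]: "A \<in> Obj V" "B \<in> Obj V"
  shows "(fob \<phi> (A \<otimes> B), chi T A B, fob \<phi> A \<otimes>\<^bsub>W\<^esub> fob \<phi> B) \<in> hom W (fob \<phi> (A \<otimes> B)) (fob \<phi> A \<otimes>\<^bsub>W\<^esub> fob \<phi> B)"
  using EM_tensor_algebra[OF free_algebra free_algebra, of A B]
  by (simp add: in_hom_EM free_algebra chi_mult hom_def comp_assoc)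

text \<open>
  The free functor is opmonoidal, so it preserves comonoids: naturality of \<open>\<chi>\<close> brings the two
  structure maps of \<open>C\<close> together under \<open>T\<close>, where the axioms of \<open>C\<close> apply.
\<close>

lemma free_comonoid:
  fixes C :: "('a, 'b) comonoid"
  assumes "comonoid V C"
  shows "comonoid W (free_comonoid V T C)"
proof -
  interpret W: strict_monoidal_category W by (rule strict_monoidal_EM)
  interpret comonoid V C by fact
  interpret F: cfunctor V W \<phi>
    using free_adjunction by (simp add: adjunction_def)
  let ?c = "car C" and ?d = "delta C" and ?e = "eps C"
  let ?D = "chi T ?c ?c \<cdot> farr T ?d" and ?E = "theta T \<cdot> farr T ?e"
  let ?X = "fob \<phi> ?c"
  have delta: "(?X, ?D, ?X \<otimes>\<^bsub>W\<^esub> ?X) \<in> hom W ?X (?X \<otimes>\<^bsub>W\<^esub> ?X)"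
    using W.compose_in[OF F.farr_in[OF delta_in] chi_algebra_map[of ?c ?c]] by simp
  have theta: "(fob \<phi> \<I>, theta T, (\<I>, theta T)) \<in> hom W (fob \<phi> \<I>) (\<I>, theta T)"
    by (simp add: in_hom_EM free_algebra unit_algebra theta_mult hom_def)
  then have eps: "(?X, ?E, (\<I>, theta T)) \<in> hom W ?X (\<I>, theta T)"
    using W.compose_in[OF F.farr_in[OF eps_in] theta] by simp
  have "(?D \<boxtimes> ident V (fob T ?c)) \<cdot> ?D
      = (chi T ?c ?c \<boxtimes> ident V (fob T ?c)) \<cdot> ((farr T ?d \<boxtimes> farr T (ident V ?c)) \<cdot> chi T ?c ?c) \<cdot> farr T ?d"
    by (simp add: interchange flip: comp_assoc)
  also have "(farr T ?d \<boxtimes> farr T (ident V ?c)) \<cdot> chi T ?c ?c = chi T (?c \<otimes> ?c) ?c \<cdot> farr T (?d \<boxtimes> ident V ?c)"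
    using chi_naturality[of ?d "ident V ?c"] by simp
  also have "(chi T ?c ?c \<boxtimes> ident V (fob T ?c)) \<cdot> (chi T (?c \<otimes> ?c) ?c \<cdot> farr T (?d \<boxtimes> ident V ?c)) \<cdot> farr T ?d
      = ((chi T ?c ?c \<boxtimes> ident V (fob T ?c)) \<cdot> chi T (?c \<otimes> ?c) ?c) \<cdot> farr T ((?d \<boxtimes> ident V ?c) \<cdot> ?d)"
    by (simp add: comp_assoc farr_comp)
  also have "\<dots> = (ident V (fob T ?c) \<boxtimes> chi T ?c ?c) \<cdot> (chi T ?c (?c \<otimes> ?c) \<cdot> farr T (ident V ?c \<boxtimes> ?d)) \<cdot> farr T ?d"
    by (simp add: chi_coassoc coassoc comp_assoc farr_comp)
  also have "chi T ?c (?c \<otimes> ?c) \<cdot> farr T (ident V ?c \<boxtimes> ?d) = (farr T (ident V ?c) \<boxtimes> farr T ?d) \<cdot> chi T ?c ?c"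
    using chi_naturality[of "ident V ?c" ?d] by simp
  also have "(ident V (fob T ?c) \<boxtimes> chi T ?c ?c) \<cdot> ((farr T (ident V ?c) \<boxtimes> farr T ?d) \<cdot> chi T ?c ?c) \<cdot> farr T ?d
      = (ident V (fob T ?c) \<boxtimes> ?D) \<cdot> ?D"
    by (simp add: interchange flip: comp_assoc)
  finally have coassoc: "(?D \<boxtimes> ident V (fob T ?c)) \<cdot> ?D = (ident V (fob T ?c) \<boxtimes> ?D) \<cdot> ?D" .
  have "(?E \<boxtimes> ident V (fob T ?c)) \<cdot> ?D
      = (theta T \<boxtimes> ident V (fob T ?c)) \<cdot> ((farr T ?e \<boxtimes> farr T (ident V ?c)) \<cdot> chi T ?c ?c) \<cdot> farr T ?d"
    by (simp add: interchange flip: comp_assoc)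
  also have "(farr T ?e \<boxtimes> farr T (ident V ?c)) \<cdot> chi T ?c ?c = chi T \<I> ?c \<cdot> farr T (?e \<boxtimes> ident V ?c)"
    using chi_naturality[of ?e "ident V ?c"] by simp
  also have "(theta T \<boxtimes> ident V (fob T ?c)) \<cdot> (chi T \<I> ?c \<cdot> farr T (?e \<boxtimes> ident V ?c)) \<cdot> farr T ?d
      = ((theta T \<boxtimes> ident V (fob T ?c)) \<cdot> chi T \<I> ?c) \<cdot> farr T ((?e \<boxtimes> ident V ?c) \<cdot> ?d)"
    by (simp add: comp_assoc farr_comp)
  finally have counit_left: "(?E \<boxtimes> ident V (fob T ?c)) \<cdot> ?D = ident V (fob T ?c)"
    by (simp add: chi_counit_left counit_left)
  have "(ident V (fob T ?c) \<boxtimes> ?E) \<cdot> ?D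
      = (ident V (fob T ?c) \<boxtimes> theta T) \<cdot> ((farr T (ident V ?c) \<boxtimes> farr T ?e) \<cdot> chi T ?c ?c) \<cdot> farr T ?d"
    by (simp add: interchange flip: comp_assoc)
  also have "(farr T (ident V ?c) \<boxtimes> farr T ?e) \<cdot> chi T ?c ?c = chi T ?c \<I> \<cdot> farr T (ident V ?c \<boxtimes> ?e)"
    using chi_naturality[of "ident V ?c" ?e] by simp
  also have "(ident V (fob T ?c) \<boxtimes> theta T) \<cdot> (chi T ?c \<I> \<cdot> farr T (ident V ?c \<boxtimes> ?e)) \<cdot> farr T ?d
      = ((ident V (fob T ?c) \<boxtimes> theta T) \<cdot> chi T ?c \<I>) \<cdot> farr T ((ident V ?c \<boxtimes> ?e) \<cdot> ?d)"
    by (simp add: comp_assoc farr_comp)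
  finally have counit_right: "(ident V (fob T ?c) \<boxtimes> ?E) \<cdot> ?D = ident V (fob T ?c)"
    by (simp add: chi_counit_right counit_right)
  have alg: "is_algebra V T (fob T ?c, mult T ?c)"
    by (simp add: free_algebra)
  note [simp del] = EM_tensor_simp
  show ?thesis
    using delta eps EM_tensor_assoc[OF alg alg alg] EM_tensor_unit[OF alg]
    by unfold_locales
      (simp_all add: free_comonoid_def Let_def alg coassoc counit_left counit_right)
qed

end

section \<open>Comodules induced by a grouplike element\<close>

text \<open>
  The trivial comonoid with the identity of \<open>\<I>\<close> is an instance of this locale, so the two functors
  \<open>K\<close> are treated together.
\<close>

locale grouplike_opmonoidal = opmonoidal_monad V T + comonoid V C for V :: "('o, 'a) monoidal_category" (structure)
    and T :: "('o, 'a) opmonoidal_monad" and C :: "('o, 'a) comonoid" +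
  fixes g
  assumes grouplike: "grouplike V C g"
begin

abbreviation D where "D \<equiv> free_comonoid V T C"

definition coaction where
  "coaction A = (fob \<phi> A, (ident V (fob T A) \<boxtimes> farr T g) \<cdot> chi T A \<I>, fob \<phi> A \<otimes>\<^bsub>W\<^esub> fob \<phi> (car C))"

lemma K_functor_eq_lift: "K_functor V T g C = lift_functor V \<phi> coaction"
  by (simp add: K_functor_def lift_functor_def coaction_def Let_def)

lemma grouplike_hom [simp]: "g \<in> Arr V" "Dom V g = \<I>" "Cod V g = car C"
  and eps_grouplike: "eps C \<cdot> g = ident V \<I>"
  and delta_grouplike: "delta C \<cdot> g = g \<boxtimes> g"
  using grouplike by (auto simp: grouplike_def comonoid_morphism_def trivial_comonoid_def hom_def)

lemma coaction_hom:
  assumes [simp]: "A \<in> Obj V"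
  shows "coaction A \<in> hom W (fob \<phi> A) (fob \<phi> A \<otimes>\<^bsub>W\<^esub> fob \<phi> (car C))"
proof -
  interpret W: strict_monoidal_category W by (rule strict_monoidal_EM)
  interpret F: cfunctor V W \<phi>
    using free_adjunction by (simp add: adjunction_def)
  have "farr \<phi> (ident V A) \<boxtimes>\<^bsub>W\<^esub> farr \<phi> g \<in> hom W (fob \<phi> A \<otimes>\<^bsub>W\<^esub> fob \<phi> \<I>) (fob \<phi> A \<otimes>\<^bsub>W\<^esub> fob \<phi> (car C))"
    by (rule W.tensor_arr_in; rule F.farr_in) (simp_all add: hom_def)
  from W.compose_in[OF chi_algebra_map[of A \<I>] this] show ?thesis
    by (simp add: coaction_def)
qed

text \<open>
  Both sides of coassociativity become \<open>(T A \<otimes> T g \<otimes> T g)\<close> after a twofold \<open>\<chi>\<close>, because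
  \<open>\<delta> \<circ> g = g \<otimes> g\<close>; the counit law reduces in the same way to \<open>\<epsilon> \<circ> g = 1\<close>.
\<close>

lemma coaction_comodule:
  assumes [simp]: "A \<in> Obj V"
  shows "is_coalgebra W (comonoid_comonad W D) (fob \<phi> A, coaction A)"
proof -
  let ?c = "car C" and ?TA = "ident V (fob T A)" and ?Tg = "farr T g"
  let ?r = "(?TA \<boxtimes> ?Tg) \<cdot> chi T A \<I>"
  have "(?r \<boxtimes> ident V (fob T ?c)) \<cdot> ?r
      = (((?TA \<boxtimes> ?Tg) \<boxtimes> ?Tg) \<cdot> (chi T A \<I> \<boxtimes> ident V (fob T \<I>))) \<cdot> chi T (A \<otimes> \<I>) \<I>"
    by (simp add: interchange del: tensor_arr_assoc flip: comp_assoc)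
  also have "\<dots> = ((?TA \<boxtimes> (?Tg \<boxtimes> ?Tg)) \<cdot> (?TA \<boxtimes> chi T \<I> \<I>)) \<cdot> chi T A \<I>"
    using chi_coassoc[of A \<I> \<I>] by (simp add: comp_assoc)
  also have "\<dots> = (?TA \<boxtimes> ((?Tg \<boxtimes> ?Tg) \<cdot> chi T \<I> \<I>)) \<cdot> chi T A \<I>"
    by (subst interchange) simp_all
  also have "(?Tg \<boxtimes> ?Tg) \<cdot> chi T \<I> \<I> = chi T ?c ?c \<cdot> farr T (delta C \<cdot> g)"
    using chi_naturality[of g g] by (simp add: delta_grouplike)
  also have "(?TA \<boxtimes> \<dots>) \<cdot> chi T A \<I> = (?TA \<boxtimes> (chi T ?c ?c \<cdot> farr T (delta C))) \<cdot> ?r"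
    by (simp add: interchange farr_comp flip: comp_assoc)
  finally have comult: "(?r \<boxtimes> ident V (fob T ?c)) \<cdot> ?r = (?TA \<boxtimes> (chi T ?c ?c \<cdot> farr T (delta C))) \<cdot> ?r" .
  have "(?TA \<boxtimes> (theta T \<cdot> farr T (eps C))) \<cdot> ?r
      = ((?TA \<boxtimes> (theta T \<cdot> farr T (eps C))) \<cdot> (?TA \<boxtimes> ?Tg)) \<cdot> chi T A \<I>"
    by (simp add: comp_assoc)
  also have "(?TA \<boxtimes> (theta T \<cdot> farr T (eps C))) \<cdot> (?TA \<boxtimes> ?Tg) = ?TA \<boxtimes> (theta T \<cdot> farr T (eps C \<cdot> g))"
    by (simp add: interchange farr_comp comp_assoc)
  finally have counit: "(?TA \<boxtimes> (theta T \<cdot> farr T (eps C))) \<cdot> ?r = ?TA"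
    by (simp add: eps_grouplike chi_counit_right)
  have alg: "is_algebra V T (fob T A, mult T A)" "is_algebra V T (fob T ?c, mult T ?c)"
    by (simp_all add: free_algebra)
  note [simp del] = EM_tensor_simp
  show ?thesis
    using coaction_hom[of A] comult counit alg EM_tensor_assoc[OF alg(1,2,2)] EM_tensor_unit[OF alg(1)]
    by (simp add: is_coalgebra_def comonoid_comonad_def coaction_def free_comonoid_def Let_def)
qed

lemma coaction_naturality:
  assumes [simp]: "f \<in> Arr V"
  shows "coaction (Cod V f) \<cdot>\<^bsub>W\<^esub> farr \<phi> f = farr (comonoid_comonad W D) (farr \<phi> f) \<cdot>\<^bsub>W\<^esub> coaction (Dom V f)"
proof -
  let ?A = "Dom V f" and ?B = "Cod V f"
  have "((ident V (fob T ?B) \<boxtimes> farr T g) \<cdot> chi T ?B \<I>) \<cdot> farr T f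
      = (ident V (fob T ?B) \<boxtimes> farr T g) \<cdot> (chi T ?B \<I> \<cdot> farr T (f \<boxtimes> ident V \<I>))"
    by (simp add: comp_assoc)
  also have "chi T ?B \<I> \<cdot> farr T (f \<boxtimes> ident V \<I>) = (farr T f \<boxtimes> ident V (fob T \<I>)) \<cdot> chi T ?A \<I>"
    using chi_naturality[of f "ident V \<I>"] by simp
  also have "(ident V (fob T ?B) \<boxtimes> farr T g) \<cdot> \<dots>
      = (farr T f \<boxtimes> ident V (fob T (car C))) \<cdot> ((ident V (fob T ?A) \<boxtimes> farr T g) \<cdot> chi T ?A \<I>)"
    by (simp add: interchange flip: comp_assoc)
  finally show ?thesis
    by (simp add: coaction_def comonoid_comonad_def free_comonoid_def Let_def)
qed

lemma lift: "coalgebra_lift V W \<phi> forgetful_functor (munit T) (EM_counit V T) (comonoid_comonad W D) coaction"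
  by (intro coalgebra_lift.intro coalgebra_lift_axioms.intro free_adjunction comonoid_comonad
      free_comonoid comonoid_axioms coaction_comodule coaction_naturality)

end

section \<open>The Galois map\<close>

context opmonoidal_monad
begin

text \<open>
  The canonical map for the trivial comonoid; at a free algebra it is the map whose invertibility
  makes \<open>T\<close> Galois.
\<close>

definition galois_map where
  "galois_map A h = (h \<boxtimes> ident V (fob T \<I>)) \<cdot> chi T A \<I>"

lemma galois_map_hom [simp]:
  assumes "is_algebra V T (A, h)"
  shows "galois_map A h \<in> Arr V" "Dom V (galois_map A h) = fob T A"
    "Cod V (galois_map A h) = A \<otimes> fob T \<I>"
  using algebraD[OF assms] by (simp_all add: galois_map_def)

lemma galois_map_naturality:
  assumes "is_algebra V T (A, h)" "is_algebra V T (B, k)" "f \<in> hom V A B" and f: "f \<cdot> h = k \<cdot> farr T f"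
  shows "galois_map B k \<cdot> farr T f = (f \<boxtimes> ident V (fob T \<I>)) \<cdot> galois_map A h"
proof -
  note [simp] = algebraD(1-4)[OF assms(1)] algebraD(1-4)[OF assms(2)]
  have [simp]: "f \<in> Arr V" "Dom V f = A" "Cod V f = B"
    using assms by (auto simp: hom_def)
  have "galois_map B k \<cdot> farr T f = (k \<boxtimes> ident V (fob T \<I>)) \<cdot> (chi T B \<I> \<cdot> farr T (f \<boxtimes> ident V \<I>))"
    by (simp add: galois_map_def comp_assoc)
  also have "chi T B \<I> \<cdot> farr T (f \<boxtimes> ident V \<I>) = (farr T f \<boxtimes> ident V (fob T \<I>)) \<cdot> chi T A \<I>"
    using chi_naturality[of f "ident V \<I>"] by simp
  also have "(k \<boxtimes> ident V (fob T \<I>)) \<cdot> \<dots> = (f \<boxtimes> ident V (fob T \<I>)) \<cdot> galois_map A h"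
    by (simp add: galois_map_def interchange f flip: comp_assoc)
  finally show ?thesis .
qed

lemma Galois_iff_galois_map_iso_on_free:
  "Galois V (comonoid_comonad V (T_unit_comonoid V T)) T (\<lambda>A. chi T A \<I>) \<longleftrightarrow>
    (\<forall>A \<in> Obj V. is_iso V (galois_map (fob T A) (mult T A)))"
  by (simp add: Galois_def comonoid_comonad_def T_unit_comonoid_def galois_map_def)

text \<open>
  In \<open>V\<close>, the algebra \<open>(A, h)\<close> is the coequalizer of the free algebras on \<open>T A\<close> and \<open>A\<close>, split by the
  unit of the monad, and the Galois map is natural in the algebra.  Hence its inverse at \<open>(A, h)\<close> is
  induced from the inverse \<open>d0\<close> at the free algebra on \<open>A\<close>, as \<open>T h \<circ> d0 \<circ> (e \<otimes> T \<I>)\<close>.  The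
  equation \<open>s \<circ> can = 1\<close> is checked after the split epimorphism \<open>T h\<close>.
\<close>

lemma galois_map_iso_if_iso_on_free:
  assumes free: "\<And>A. A \<in> Obj V \<Longrightarrow> is_iso V (galois_map (fob T A) (mult T A))"
    and X: "is_algebra V T (A, h)"
  shows "is_iso V (galois_map A h)"
proof -
  note [simp] = algebraD(1-4)[OF X] free_algebra X
  note h_mult = algebraD(5)[OF X] and h_munit = algebraD(6)[OF X]
  let ?I = "ident V (fob T \<I>)"
  let ?can = "galois_map A h" and ?can_T = "galois_map (fob T A) (mult T A)"
    and ?can_TT = "galois_map (fob T (fob T A)) (mult T (fob T A))"
  obtain d0 where d0: "d0 \<in> hom V (fob T A \<otimes> fob T \<I>) (fob T (fob T A))"
      "d0 \<cdot> ?can_T = ident V (fob T (fob T A))" "?can_T \<cdot> d0 = ident V (fob T A \<otimes> fob T \<I>)"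
    by (rule is_isoE[OF free[of A]]) (simp_all add: hom_def)
  obtain d1 where d1: "d1 \<in> hom V (fob T (fob T A) \<otimes> fob T \<I>) (fob T (fob T (fob T A)))"
      "d1 \<cdot> ?can_TT = ident V (fob T (fob T (fob T A)))"
      "?can_TT \<cdot> d1 = ident V (fob T (fob T A) \<otimes> fob T \<I>)"
    by (rule is_isoE[OF free[of "fob T A"]]) (simp_all add: hom_def)
  have [simp]: "d0 \<in> Arr V" "Dom V d0 = fob T A \<otimes> fob T \<I>" "Cod V d0 = fob T (fob T A)"
    "d1 \<in> Arr V" "Dom V d1 = fob T (fob T A) \<otimes> fob T \<I>" "Cod V d1 = fob T (fob T (fob T A))"
    using d0(1) d1(1) by (auto simp: hom_def)
  \<comment> \<open>Naturality of the inverse; it is used for the parallel pair \<open>T h\<close> and \<open>m\<close>.\<close>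
  have d_nat: "d0 \<cdot> (f \<boxtimes> ?I) = farr T f \<cdot> d1"
    if f: "f \<in> hom V (fob T (fob T A)) (fob T A)" "f \<cdot> mult T (fob T A) = mult T A \<cdot> farr T f" for f
  proof -
    have [simp]: "f \<in> Arr V" "Dom V f = fob T (fob T A)" "Cod V f = fob T A"
      using f by (auto simp: hom_def)
    have "d0 \<cdot> (f \<boxtimes> ?I) = d0 \<cdot> (((f \<boxtimes> ?I) \<cdot> ?can_TT) \<cdot> d1)"
      by (simp add: comp_assoc d1(3))
    also have "(f \<boxtimes> ?I) \<cdot> ?can_TT = ?can_T \<cdot> farr T f"
      using galois_map_naturality[OF _ _ f] by simp
    also have "d0 \<cdot> ((?can_T \<cdot> farr T f) \<cdot> d1) = (d0 \<cdot> ?can_T) \<cdot> (farr T f \<cdot> d1)"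
      by (simp add: comp_assoc)
    finally show ?thesis by (simp add: d0(2))
  qed
  have c_h: "?can \<cdot> farr T h = (h \<boxtimes> ?I) \<cdot> ?can_T"
    by (rule galois_map_naturality) (simp_all add: hom_def h_mult)
  define s where "s = farr T h \<cdot> (d0 \<cdot> (munit T A \<boxtimes> ?I))"
  have s [simp]: "s \<in> Arr V" "Dom V s = A \<otimes> fob T \<I>" "Cod V s = fob T A"
    by (simp_all add: s_def)
  have "?can \<cdot> s = (?can \<cdot> farr T h) \<cdot> (d0 \<cdot> (munit T A \<boxtimes> ?I))"
    by (simp add: s_def comp_assoc)
  also have "\<dots> = (h \<boxtimes> ?I) \<cdot> ((?can_T \<cdot> d0) \<cdot> (munit T A \<boxtimes> ?I))"
    by (simp add: c_h comp_assoc)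
  also have "\<dots> = ident V (A \<otimes> fob T \<I>)"
    by (simp add: d0(3) interchange h_munit)
  finally have cs: "?can \<cdot> s = ident V (A \<otimes> fob T \<I>)" .
  have "(s \<cdot> ?can) \<cdot> farr T h = s \<cdot> ((h \<boxtimes> ?I) \<cdot> ?can_T)"
    by (simp add: c_h comp_assoc)
  also have "\<dots> = farr T h \<cdot> (d0 \<cdot> (((munit T A \<cdot> h) \<boxtimes> ?I) \<cdot> ?can_T))"
    by (simp add: s_def comp_assoc) (simp add: interchange flip: comp_assoc)
  also have "munit T A \<cdot> h = farr T h \<cdot> munit T (fob T A)"
    using munit_naturality[of h] by simp
  also have "(farr T h \<cdot> munit T (fob T A)) \<boxtimes> ?I = (farr T h \<boxtimes> ?I) \<cdot> (munit T (fob T A) \<boxtimes> ?I)"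
    by (simp add: interchange)
  also have "farr T h \<cdot> (d0 \<cdot> (((farr T h \<boxtimes> ?I) \<cdot> (munit T (fob T A) \<boxtimes> ?I)) \<cdot> ?can_T))
      = farr T h \<cdot> ((d0 \<cdot> (farr T h \<boxtimes> ?I)) \<cdot> ((munit T (fob T A) \<boxtimes> ?I) \<cdot> ?can_T))"
    by (simp add: comp_assoc)
  also have "d0 \<cdot> (farr T h \<boxtimes> ?I) = farr T (farr T h) \<cdot> d1"
    using mult_naturality[of h] by (intro d_nat) (simp_all add: hom_def)
  also have "farr T h \<cdot> ((farr T (farr T h) \<cdot> d1) \<cdot> ((munit T (fob T A) \<boxtimes> ?I) \<cdot> ?can_T))
      = farr T (h \<cdot> farr T h) \<cdot> (d1 \<cdot> ((munit T (fob T A) \<boxtimes> ?I) \<cdot> ?can_T))"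
    by (simp add: comp_assoc farr_comp)
  also have "\<dots> = farr T h \<cdot> ((farr T (mult T A) \<cdot> d1) \<cdot> ((munit T (fob T A) \<boxtimes> ?I) \<cdot> ?can_T))"
    by (simp add: comp_assoc farr_comp flip: h_mult)
  also have "farr T (mult T A) \<cdot> d1 = d0 \<cdot> (mult T A \<boxtimes> ?I)"
    using mult_assoc[of A] by (intro d_nat[symmetric]) (simp_all add: hom_def)
  also have "farr T h \<cdot> ((d0 \<cdot> (mult T A \<boxtimes> ?I)) \<cdot> ((munit T (fob T A) \<boxtimes> ?I) \<cdot> ?can_T))
      = farr T h \<cdot> (d0 \<cdot> (((mult T A \<boxtimes> ?I) \<cdot> (munit T (fob T A) \<boxtimes> ?I)) \<cdot> ?can_T))"
    by (simp add: comp_assoc)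
  also have "\<dots> = farr T h"
    by (simp add: interchange munit_left d0(2))
  finally have sc_h: "(s \<cdot> ?can) \<cdot> farr T h = farr T h" .
  have h_split: "farr T h \<cdot> farr T (munit T A) = ident V (fob T A)"
    by (simp add: h_munit flip: farr_comp)
  have "s \<cdot> ?can = (s \<cdot> ?can) \<cdot> (farr T h \<cdot> farr T (munit T A))"
    by (simp add: h_split)
  also have "\<dots> = ((s \<cdot> ?can) \<cdot> farr T h) \<cdot> farr T (munit T A)"
    by (simp add: comp_assoc)
  finally have sc: "s \<cdot> ?can = ident V (fob T A)"
    by (simp only: sc_h h_split)
  show ?thesis
    by (rule is_isoI[OF _ _ sc cs]) (simp_all add: hom_def)
qed

text \<open>
  The forgetful functor reflects isomorphisms: the inverse of an algebra map is an algebra map.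
\<close>

lemma is_iso_EM_iff:
  assumes k: "(X, f, Y) \<in> Arr W"
  shows "is_iso W (X, f, Y) \<longleftrightarrow> is_iso V f"
proof
  interpret adjunction V W \<phi> forgetful_functor "munit T" "EM_counit V T"
    by (rule free_adjunction)
  show "is_iso W (X, f, Y) \<Longrightarrow> is_iso V f"
    using U.preserves_iso[of "(X, f, Y)"] by (simp add: forgetful_functor_def)
  assume iso: "is_iso V f"
  obtain A h B l where XY: "X = (A, h)" "Y = (B, l)" by (cases X; cases Y)
  have alg: "is_algebra V T (A, h)" "is_algebra V T (B, l)" and f: "f \<in> hom V A B"
    and fh: "f \<cdot> h = l \<cdot> farr T f"
    using k by (simp_all add: XY)
  note [simp] = algebraD(1-4)[OF alg(1)] algebraD(1-4)[OF alg(2)]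
  obtain j where j: "j \<in> hom V B A" "j \<cdot> f = ident V A" "f \<cdot> j = ident V B"
    using is_isoE[OF iso f] .
  have [simp]: "f \<in> Arr V" "Dom V f = A" "Cod V f = B" "j \<in> Arr V" "Dom V j = B" "Cod V j = A"
    using f j(1) by (auto simp: hom_def)
  have "j \<cdot> l = j \<cdot> (l \<cdot> farr T (f \<cdot> j))"
    by (simp add: j(3))
  also have "\<dots> = j \<cdot> ((l \<cdot> farr T f) \<cdot> farr T j)"
    by (simp add: farr_comp comp_assoc)
  also have "\<dots> = (j \<cdot> f) \<cdot> (h \<cdot> farr T j)"
    by (simp add: comp_assoc flip: fh)
  finally have jl: "j \<cdot> l = h \<cdot> farr T j"
    by (simp add: j(2))
  show "is_iso W (X, f, Y)"
    by (rule F.target.is_isoI[of _ "(A, h)" "(B, l)" "((B, l), j, (A, h))"])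
      (simp_all add: in_hom_EM XY alg fh jl f j)
qed

end

section \<open>The three conditions\<close>

context grouplike_opmonoidal
begin

definition canonical_map where
  "canonical_map A h = (h \<boxtimes> farr T g) \<cdot> chi T A \<I>"

lemma canonical_map_factor:
  assumes "is_algebra V T (A, h)"
  shows "canonical_map A h = (ident V A \<boxtimes> farr T g) \<cdot> galois_map A h"
  using algebraD[OF assms]
  by (simp add: canonical_map_def galois_map_def interchange flip: comp_assoc)

text \<open>
  The general criterion for the comonad \<open>- \<otimes> \<phi>(C)\<close>: the canonical map of the lift has underlying
  arrow \<open>(h \<otimes> T g) \<circ> \<chi>\<close>, whose invertibility can be tested in \<open>V\<close>.
\<close>

lemma equivalence_iff_effective_descent_and_canonical_map_iso:
  "equivalence_of_categories V (EM_comodule_category V T C) (K_functor V T g C) \<longleftrightarrow>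
    effective_descent_type V T \<and> (\<forall>A h. is_algebra V T (A, h) \<longrightarrow> is_iso V (canonical_map A h))"
proof -
  interpret lift: coalgebra_lift V W \<phi> forgetful_functor "munit T" "EM_counit V T"
      "comonoid_comonad W D" coaction
    by (rule lift)
  have "comonadic V W \<phi> forgetful_functor (munit T) (EM_counit V T) \<longleftrightarrow> effective_descent_type V T"
    by (simp add: effective_descent_type_def comonadic_def coalgebra_category_EM_monoidal)
  moreover have "is_iso W (lift.canonical (A, h)) \<longleftrightarrow> is_iso V (canonical_map A h)"
    if X: "is_algebra V T (A, h)" for A h
  proof -
    let ?Y = "EM_tensor V T (A, h) (fob \<phi> (car C))"
    note [simp] = algebraD(1-4)[OF X]
    have "lift.canonical (A, h) = (fob \<phi> A, canonical_map A h, ?Y)"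
      unfolding lift.canonical_def
      by (simp add: EM_counit_def forgetful_functor_def comonoid_comonad_def
          coaction_def free_comonoid_def Let_def canonical_map_def interchange flip: comp_assoc)
    moreover have "lift.canonical (A, h) \<in> Arr W"
      using X by (intro lift.canonical_hom) simp
    ultimately show ?thesis
      using is_iso_EM_iff by simp
  qed
  ultimately show ?thesis
    using lift.equivalence_iff_comonadic_and_canonical_iso
    by (auto simp: K_functor_eq_lift EM_comodule_category_def comodule_category_eq_coalgebra_category)
qed

text \<open>
  At the unit algebra the counit law for \<open>\<theta>\<close> reduces the canonical map to \<open>T g\<close>.
\<close>

lemma grouplike_iso_if_canonical_map_iso:
  assumes descent: "effective_descent_type V T"
    and iso: "\<And>A h. is_algebra V T (A, h) \<Longrightarrow> is_iso V (canonical_map A h)"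
  shows "is_iso V g"
proof -
  interpret adjunction V W \<phi> forgetful_functor "munit T" "EM_counit V T"
    by (rule free_adjunction)
  have "canonical_map \<I> (theta T) = farr T g \<cdot> ((theta T \<boxtimes> ident V (fob T \<I>)) \<cdot> chi T \<I> \<I>)"
    using interchange[of "theta T" "ident V \<I>" "ident V (fob T \<I>)" "farr T g"]
    by (simp add: canonical_map_def flip: comp_assoc)
  then have "is_iso V (farr T g)"
    using iso[OF unit_algebra] by (simp add: chi_counit_left)
  then have "is_iso W (farr \<phi> g)"
    using is_iso_EM_iff F.farr_Arr[of g] by simp
  moreover have "comonadic V W \<phi> forgetful_functor (munit T) (EM_counit V T)"
    using descent by (simp add: effective_descent_type_def comonadic_def coalgebra_category_EM_monoidal)
  ultimately show ?thesis
    using reflects_iso_if_comonadic[of g \<I> "car C"] by (simp add: hom_def)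
qed

lemma canonical_map_iso_iff_galois_map_iso:
  assumes g: "is_iso V g" and X: "is_algebra V T (A, h)"
  shows "is_iso V (canonical_map A h) \<longleftrightarrow> is_iso V (galois_map A h)"
proof -
  note [simp] = algebraD(1-4)[OF X]
  have "is_iso V (farr T g)"
    using g by (rule preserves_iso)
  then obtain j where j: "j \<in> hom V (fob T (car C)) (fob T \<I>)" "j \<cdot> farr T g = ident V (fob T \<I>)"
      "farr T g \<cdot> j = ident V (fob T (car C))"
    by (rule is_isoE) (simp_all add: hom_def)
  have [simp]: "j \<in> Arr V" "Dom V j = fob T (car C)" "Cod V j = fob T \<I>"
    using j(1) by (auto simp: hom_def)
  have i: "is_iso V (ident V A \<boxtimes> farr T g)"
    by (rule is_isoI[of _ "A \<otimes> fob T \<I>" "A \<otimes> fob T (car C)" "ident V A \<boxtimes> j"])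
      (simp_all add: hom_def interchange j(2,3))
  have hom: "ident V A \<boxtimes> farr T g \<in> hom V (A \<otimes> fob T \<I>) (A \<otimes> fob T (car C))"
      "galois_map A h \<in> hom V (fob T A) (A \<otimes> fob T \<I>)"
    using X by (simp_all add: hom_def)
  show ?thesis
    unfolding canonical_map_factor[OF X]
    using iso_comp[OF _ hom(2) i hom(1)] iso_cancel_left[OF i hom(1,2)] by blast
qed

end

theorem theorem3p8:
  fixes V :: "('o, 'a) monoidal_category"
    and T :: "('o, 'a) opmonoidal_monad"
    and C :: "('o, 'a) comonoid"
    and g :: 'a
  assumes "strict_monoidal_category V"
    and "opmonoidal_monad V T"
    and "comonoid V C"
    and "grouplike V C g"
  shows "(equivalence_of_categories V (EM_comodule_category V T C) (K_functor V T g C)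
      \<longleftrightarrow>
      equivalence_of_categories V (EM_comodule_category V T (trivial_comonoid V))
        (K_functor V T (ident V \<I>\<^bsub>V\<^esub>) (trivial_comonoid V)) \<and> is_iso V g)
    \<and>
    (equivalence_of_categories V (EM_comodule_category V T (trivial_comonoid V))
        (K_functor V T (ident V \<I>\<^bsub>V\<^esub>) (trivial_comonoid V)) \<and> is_iso V g
      \<longleftrightarrow>
      Galois V (comonoid_comonad V (T_unit_comonoid V T)) T (\<lambda>A. chi T A \<I>\<^bsub>V\<^esub>) \<and>
      effective_descent_type V T \<and>
      is_iso V g)"
proof -
  interpret opmonoidal_monad V T by fact
  interpret g: grouplike_opmonoidal V T C g
    by (intro grouplike_opmonoidal.intro grouplike_opmonoidal_axioms.intro assms)
  have "comonoid V (trivial_comonoid V)"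
    by unfold_locales (simp_all add: trivial_comonoid_def hom_def)
  then interpret one: grouplike_opmonoidal V T "trivial_comonoid V" "ident V \<I>\<^bsub>V\<^esub>"
    by (intro grouplike_opmonoidal.intro grouplike_opmonoidal_axioms.intro assms(2))
      (simp_all add: grouplike_def comonoid_morphism_def trivial_comonoid_def hom_def)
  have one_canonical: "one.canonical_map A h = galois_map A h" for A h
    by (simp add: one.canonical_map_def galois_map_def)
  have "(\<forall>A h. is_algebra V T (A, h) \<longrightarrow> is_iso V (galois_map A h)) \<longleftrightarrow>
      Galois V (comonoid_comonad V (T_unit_comonoid V T)) T (\<lambda>A. chi T A \<I>\<^bsub>V\<^esub>)"
    unfolding Galois_iff_galois_map_iso_on_free
    using galois_map_iso_if_iso_on_free free_algebra by blast
  then show ?thesis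
    using g.grouplike_iso_if_canonical_map_iso g.canonical_map_iso_iff_galois_map_iso
    unfolding g.equivalence_iff_effective_descent_and_canonical_map_iso
      one.equivalence_iff_effective_descent_and_canonical_map_iso one_canonical
    by blast
qed

end
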